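(* In the setting below, assume that $I_h$ satisfies the $H^1$-convergence condition (ii). Then $$\limsup_{h\to0}\tilde\lambda_{h,1}\le\lambda_1.$$
   Context: Setting. Let $d\in\{2,3\}$ and let $\Omega_0,\Omega_1\subset\mathbb R^d$ be bounded open polyhedral domains. Let $T:\Omega_0\to\Omega_1$ be a volume-preserving $C^\infty$-diffeomorphism such that $T$ and $T^{-1}$ extend smoothly to the closures. For a function $u$ on $\Omega_0$ write $Tu:=u\circ T^{-1}$. For $t\in\{0,1\}$ let $a^t(u,w)=\int_{\Omega_t}\nabla u\cdot\nabla w\,d\ell^d$ on $H^1(\Omega_t)$, and let $a(u,w)=\tfrac12\big(a^0(u,w)+a^1(Tu,Tw)\big)$ on $H^1(\Omega_0)$. Let $\hat H^1(\Omega)=\{v\in H^1(\Omega):\int_\Omega v\,d\ell^d=0\}$ and $\lambda_1:=\inf\{a(v,v):v\in\hat H^1(\Omega_0),\ \|v\|_{L^2(\Omega_0)}=1\}$. Let $\{\mathcal T^0_h\}_{h>0}$ be a quasi-uniform family of conforming simplicial triangulations of $\Omega_0$ with $P^k$-Lagrange spaces $S^0_h$ (continuous piecewise polynomials of degree $\le k$), nested in the sense $S^0_{h'}\subset S^0_h$ for $h<h'$, with $\bigcup_hS^0_h$ dense in $H^1(\Omega_0)$; put $\hat S^0_h=S^0_h\cap\hat H^1(\Omega_0)$. Let $\{\mathcal T^1_h\}_{h>0}$ be a quasi-uniform family of conforming simplicial triangulations of $\Omega_1$ (unrelated to $\mathcal T^0_h$) with $P^{k'}$-Lagrange spaces $S^1_h$.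 For each $h$ let $I_h$ be a linear operator with values in $S^1_h$, defined at least on $\{Tf: f\in S^0_h\}$. Define for $u,w\in S^0_h$: $\tilde a_h(u,w)=\tfrac12\big(a^0(u,w)+a^1(I_hTu,I_hTw)\big)$, and $\tilde\lambda_{h,1}:=\min\{\tilde a_h(v,v):v\in\hat S^0_h,\ \|v\|_{L^2(\Omega_0)}=1\}$. Conditions: (i) exactness on constants: $I_hT\chi_{\Omega_0}=\chi_{\Omega_1}$; (ii) $H^1$-convergence: for every $f\in\bigcup_hS^0_h$, $\|I_hTf-Tf\|_{H^1(\Omega_1)}\to0$ as $h\to0$; (iii) $L^2$-stability: there is $C$ with $\|I_hTv\|_{L^2(\Omega_1)}\le C\|v\|_{L^2(\Omega_0)}$ for all $0<h<h'$ and all $v\in S^0_{h'}$. Quasi-uniform means: shape-regular ($h_K/\rho_K\le\sigma_0$ uniformly, $h_K$ = element diameter, $\rho_K$ = inscribed ball diameter) and $h_K\ge ch$ for all elements, with $h=\max_K h_K$. Limits $h\to0$ are along arbitrary sequences $h_n\to0$. *)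

theory Defs
  imports "HOL-Analysis.Analysis"
begin

fun Ck_on :: "nat \<Rightarrow> 'a::euclidean_space set \<Rightarrow> ('a \<Rightarrow> real) \<Rightarrow> bool" where
  "Ck_on 0 S f = continuous_on S f"
| "Ck_on (Suc k) S f = (continuous_on S f \<and> f differentiable_on S \<and>
      (\<forall>i\<in>Basis. Ck_on k S (\<lambda>x. frechet_derivative f (at x) i)))"

definition smooth_on :: "'a::euclidean_space set \<Rightarrow> ('a \<Rightarrow> real) \<Rightarrow> bool" where
  "smooth_on S f = (\<forall>k. Ck_on k S f)"

definition smooth_map_on :: "'a::euclidean_space set \<Rightarrow> ('a \<Rightarrow> 'b::euclidean_space) \<Rightarrow> bool" where
  "smooth_map_on S F = (\<forall>j\<in>Basis. smooth_on S (\<lambda>x. F x \<bullet> j))"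

definition in_L2 :: "'a::euclidean_space set \<Rightarrow> ('a \<Rightarrow> real) \<Rightarrow> bool" where
  "in_L2 \<Omega> u = (set_borel_measurable lebesgue \<Omega> u \<and> set_integrable lebesgue \<Omega> (\<lambda>x. (u x)^2))"

definition in_L2_vec :: "'a::euclidean_space set \<Rightarrow> ('a \<Rightarrow> 'a) \<Rightarrow> bool" where
  "in_L2_vec \<Omega> G = (set_borel_measurable lebesgue \<Omega> G \<and> set_integrable lebesgue \<Omega> (\<lambda>x. (norm (G x))^2))"

definition test_fun :: "'a::euclidean_space set \<Rightarrow> ('a \<Rightarrow> real) \<Rightarrow> bool" where
  "test_fun \<Omega> \<phi> = (smooth_on UNIV \<phi> \<and> compact (closure {x. \<phi> x \<noteq> 0}) \<and> closure {x. \<phi> x \<noteq> 0} \<subseteq> \<Omega>)"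

definition is_weak_grad :: "'a::euclidean_space set \<Rightarrow> ('a \<Rightarrow> real) \<Rightarrow> ('a \<Rightarrow> 'a) \<Rightarrow> bool" where
  "is_weak_grad \<Omega> u G = (in_L2 \<Omega> u \<and> in_L2_vec \<Omega> G \<and>
     (\<forall>\<phi>. test_fun \<Omega> \<phi> \<longrightarrow> (\<forall>i\<in>Basis.
        (LINT x:\<Omega>|lebesgue. u x * frechet_derivative \<phi> (at x) i)
          = - (LINT x:\<Omega>|lebesgue. (G x \<bullet> i) * \<phi> x))))"

definition H1 :: "'a::euclidean_space set \<Rightarrow> ('a \<Rightarrow> real) set" where
  "H1 \<Omega> = {u. \<exists>G. is_weak_grad \<Omega> u G}"

definition wgrad :: "'a::euclidean_space set \<Rightarrow> ('a \<Rightarrow> real) \<Rightarrow> 'a \<Rightarrow> 'a" where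
  "wgrad \<Omega> u = (SOME G. is_weak_grad \<Omega> u G)"

definition dirform :: "'a::euclidean_space set \<Rightarrow> ('a \<Rightarrow> real) \<Rightarrow> ('a \<Rightarrow> real) \<Rightarrow> real" where
  "dirform \<Omega> u w = (LINT x:\<Omega>|lebesgue. wgrad \<Omega> u x \<bullet> wgrad \<Omega> w x)"

definition L2norm :: "'a::euclidean_space set \<Rightarrow> ('a \<Rightarrow> real) \<Rightarrow> real" where
  "L2norm \<Omega> u = sqrt (LINT x:\<Omega>|lebesgue. (u x)^2)"

definition H1norm :: "'a::euclidean_space set \<Rightarrow> ('a \<Rightarrow> real) \<Rightarrow> real" where
  "H1norm \<Omega> u = sqrt (LINT x:\<Omega>|lebesgue. (u x)^2 + (norm (wgrad \<Omega> u x))^2)"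

definition mean_zero :: "'a::euclidean_space set \<Rightarrow> ('a \<Rightarrow> real) \<Rightarrow> bool" where
  "mean_zero \<Omega> v = ((LINT x:\<Omega>|lebesgue. v x) = 0)"

definition polyhedral_domain :: "'a::euclidean_space set \<Rightarrow> bool" where
  "polyhedral_domain \<Omega> = (open \<Omega> \<and> bounded \<Omega> \<and> connected \<Omega> \<and> \<Omega> \<noteq> {} \<and>
     interior (closure \<Omega>) = \<Omega> \<and>
     (\<exists>\<P>. finite \<P> \<and> (\<forall>P\<in>\<P>. polytope P) \<and> closure \<Omega> = \<Union>\<P>))"

definition triangulation :: "'a::euclidean_space set \<Rightarrow> 'a set set \<Rightarrow> bool" where
  "triangulation \<Omega> \<T> = (finite \<T> \<and> \<T> \<noteq> {} \<and>
     (\<forall>K\<in>\<T>. (int DIM('a)) simplex K) \<and> \<Union>\<T> = closure \<Omega> \<and>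
     (\<forall>K\<in>\<T>. \<forall>K'\<in>\<T>. (K \<inter> K') face_of K \<and> (K \<inter> K') face_of K'))"

definition mesh_size :: "'a::euclidean_space set set \<Rightarrow> real" where
  "mesh_size \<T> = Max (diameter ` \<T>)"

definition inball_diam :: "'a::euclidean_space set \<Rightarrow> real" where
  "inball_diam K = 2 * Sup {r. \<exists>x. ball x r \<subseteq> K}"

definition quasi_uniform :: "real set \<Rightarrow> 'a::euclidean_space set \<Rightarrow> (real \<Rightarrow> 'a set set) \<Rightarrow> bool" where
  "quasi_uniform H \<Omega> \<T> = ((\<forall>h\<in>H. triangulation \<Omega> (\<T> h) \<and> mesh_size (\<T> h) = h) \<and>
     (\<exists>\<sigma>0 c. c > 0 \<and> (\<forall>h\<in>H. \<forall>K\<in>\<T> h. diameter K \<le> \<sigma>0 * inball_diam K \<and> c * h \<le> diameter K)))"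

definition multi_indices :: "nat \<Rightarrow> ('a::euclidean_space \<Rightarrow> nat) set" where
  "multi_indices k = {\<alpha>. (\<forall>i. i \<notin> Basis \<longrightarrow> \<alpha> i = 0) \<and> sum \<alpha> Basis \<le> k}"

definition poly_on :: "'a::euclidean_space set \<Rightarrow> nat \<Rightarrow> ('a \<Rightarrow> real) \<Rightarrow> bool" where
  "poly_on K k f = (\<exists>c. \<forall>x\<in>K. f x = (\<Sum>\<alpha>\<in>multi_indices k. c \<alpha> * (\<Prod>i\<in>Basis. (x \<bullet> i) ^ \<alpha> i)))"

definition lagrange_space :: "'a::euclidean_space set set \<Rightarrow> nat \<Rightarrow> 'a set \<Rightarrow> ('a \<Rightarrow> real) set" where
  "lagrange_space \<T> k \<Omega> = {v. continuous_on (closure \<Omega>) v \<and> (\<forall>K\<in>\<T>. poly_on K k v) \<and>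
     (\<forall>x. x \<notin> closure \<Omega> \<longrightarrow> v x = 0)}"

definition push :: "'a::euclidean_space set \<Rightarrow> ('a \<Rightarrow> 'a) \<Rightarrow> ('a \<Rightarrow> real) \<Rightarrow> 'a \<Rightarrow> real" where
  "push \<Omega>1 Tinv u = (\<lambda>y. if y \<in> \<Omega>1 then u (Tinv y) else 0)"

definition aform :: "'a::euclidean_space set \<Rightarrow> 'a set \<Rightarrow> ('a \<Rightarrow> 'a) \<Rightarrow> ('a \<Rightarrow> real) \<Rightarrow> ('a \<Rightarrow> real) \<Rightarrow> real" where
  "aform \<Omega>0 \<Omega>1 Tinv u w = (dirform \<Omega>0 u w + dirform \<Omega>1 (push \<Omega>1 Tinv u) (push \<Omega>1 Tinv w)) / 2"

definition lambda1 :: "'a::euclidean_space set \<Rightarrow> 'a set \<Rightarrow> ('a \<Rightarrow> 'a) \<Rightarrow> real" where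
  "lambda1 \<Omega>0 \<Omega>1 Tinv = Inf {aform \<Omega>0 \<Omega>1 Tinv v v | v. v \<in> H1 \<Omega>0 \<and> mean_zero \<Omega>0 v \<and> L2norm \<Omega>0 v = 1}"

definition atilde :: "'a::euclidean_space set \<Rightarrow> 'a set \<Rightarrow> ('a \<Rightarrow> 'a) \<Rightarrow> (('a \<Rightarrow> real) \<Rightarrow> ('a \<Rightarrow> real))
     \<Rightarrow> ('a \<Rightarrow> real) \<Rightarrow> ('a \<Rightarrow> real) \<Rightarrow> real" where
  "atilde \<Omega>0 \<Omega>1 Tinv Ih u w =
     (dirform \<Omega>0 u w + dirform \<Omega>1 (Ih (push \<Omega>1 Tinv u)) (Ih (push \<Omega>1 Tinv w))) / 2"

text \<open>The discrete minimum over the finite-dimensional space S (attained, so Inf = min).\<close>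
definition lambda_tilde :: "'a::euclidean_space set \<Rightarrow> 'a set \<Rightarrow> ('a \<Rightarrow> 'a) \<Rightarrow> (('a \<Rightarrow> real) \<Rightarrow> ('a \<Rightarrow> real))
     \<Rightarrow> ('a \<Rightarrow> real) set \<Rightarrow> real" where
  "lambda_tilde \<Omega>0 \<Omega>1 Tinv Ih S =
     Inf {atilde \<Omega>0 \<Omega>1 Tinv Ih v v | v. v \<in> S \<and> mean_zero \<Omega>0 v \<and> L2norm \<Omega>0 v = 1}"

end

theory Submission
  imports Defs
begin

text \<open>Let \<open>v\<close> be a nearly optimal admissible function for \<open>\<lambda>\<^sub>1\<close>. By density it is an
  \<open>H\<^sup>1\<close>-limit of Lagrange functions; correcting mean and norm gives one fixed admissible \<open>z\<close> in some
  \<open>S\<^sub>h\<close> with \<open>a(z,z) < \<lambda>\<^sub>1 + \<epsilon>\<close>, because \<open>a\<close> is continuous in \<open>H\<^sup>1\<close>. By nestedness \<open>z\<close> competes in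
  the discrete problem for all smaller \<open>h\<close>, where the discrete form at \<open>z\<close> tends to \<open>a(z,z)\<close> by
  \<open>H\<^sup>1\<close>-convergence.

  The analytic content is that Lagrange functions and their push-forwards are weakly
  differentiable. Both are locally Lipschitz and differentiable off a null set, so
  integration by parts follows from difference quotients and dominated convergence.\<close>

subsection \<open>Square-integrable functions\<close>

text \<open>The forms are written with \<open>wgrad\<close>, an arbitrary choice among weak
  gradients, so every computation of an energy rests on uniqueness of weak gradients up to null
  sets, that is, on the fundamental lemma of the calculus of variations. That lemma needs a supply
  of functions satisfying the recursive predicate \<open>smooth_on\<close>; they are built
  explicitly from exp(-1/t).

  The other obstacle is the push-forward. Volume preservation is known only through measures of
  sets, so integrals transport at once but weak derivatives do not. For a general H1 function they
  are reached through two facts: the weak gradient is a closed operator, and the transformed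
  gradient \<open>pull_grad\<close> is bounded in the L2 norm.

  The competitor is fixed before h tends to 0 because the convergence hypothesis treats each
  function separately, with no uniformity over the growing spaces. Correcting mean and norm
  multiplies the gradient by a factor tending to 1, so energies survive the correction in the
  limit.\<close>

definition sq_integrable :: "'m measure \<Rightarrow> ('m \<Rightarrow> 'b::euclidean_space) \<Rightarrow> bool" where
  "sq_integrable M f \<longleftrightarrow> f \<in> borel_measurable M \<and> integrable M (\<lambda>x. (norm (f x))\<^sup>2)"

text \<open>A seminorm on functions instead of a norm on classes. The values lie in any Euclidean
  space, so that functions and their gradients share one theory.\<close>

definition norm2 :: "'m measure \<Rightarrow> ('m \<Rightarrow> 'b::euclidean_space) \<Rightarrow> real" where
  "norm2 M f = sqrt (\<integral>x. (norm (f x))\<^sup>2 \<partial>M)"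

lemma sq_integrable_measurable: "sq_integrable M f \<Longrightarrow> f \<in> borel_measurable M"
  by (simp add: sq_integrable_def)

lemma norm2_nonneg: "norm2 M f \<ge> 0"
  by (simp add: norm2_def)

lemma norm2_power2: "(norm2 M f)\<^sup>2 = (\<integral>x. (norm (f x))\<^sup>2 \<partial>M)"
  by (simp add: norm2_def)

lemma sq_integrable_inner:
  assumes "sq_integrable M f" "sq_integrable M g"
  shows "integrable M (\<lambda>x. f x \<bullet> g x)"
proof (rule Bochner_Integration.integrable_bound)
  show "integrable M (\<lambda>x. (norm (f x))\<^sup>2 + (norm (g x))\<^sup>2)"
    using assms by (auto simp: sq_integrable_def)
  show "(\<lambda>x. f x \<bullet> g x) \<in> borel_measurable M"
    using assms by (auto simp: sq_integrable_def)
  have "\<bar>a \<bullet> b\<bar> \<le> (norm a)\<^sup>2 + (norm b)\<^sup>2" for a b :: 'b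
  proof -
    have "\<bar>a \<bullet> b\<bar> \<le> norm a * norm b" by (rule Cauchy_Schwarz_ineq2)
    moreover have "2 * (norm a * norm b) \<le> (norm a)\<^sup>2 + (norm b)\<^sup>2"
      using sum_squares_bound[of "norm a" "norm b"] by simp
    moreover have "0 \<le> norm a * norm b" by simp
    ultimately show ?thesis by linarith
  qed
  then show "AE x in M. norm (f x \<bullet> g x) \<le> norm ((norm (f x))\<^sup>2 + (norm (g x))\<^sup>2)"
    by (intro AE_I2) simp
qed

lemma sq_integrable_scaleR:
  assumes "sq_integrable M f" shows "sq_integrable M (\<lambda>x. c *\<^sub>R f x)"
  using assms by (auto simp: sq_integrable_def power_mult_distrib)

lemma sq_integrable_add:
  assumes "sq_integrable M f" "sq_integrable M g"
  shows "sq_integrable M (\<lambda>x. f x + g x)"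
proof -
  have "integrable M (\<lambda>x. (norm (f x))\<^sup>2 + (norm (g x))\<^sup>2 + 2 * (f x \<bullet> g x))"
    using assms sq_integrable_inner[OF assms] by (auto simp: sq_integrable_def)
  moreover have "(norm (f x + g x))\<^sup>2 = (norm (f x))\<^sup>2 + (norm (g x))\<^sup>2 + 2 * (f x \<bullet> g x)" for x
    by (simp add: power2_norm_eq_inner algebra_simps inner_commute)
  ultimately show ?thesis
    using assms by (auto simp: sq_integrable_def)
qed

lemma sq_integrable_diff:
  assumes "sq_integrable M f" "sq_integrable M g"
  shows "sq_integrable M (\<lambda>x. f x - g x)"
  using sq_integrable_add[OF assms(1) sq_integrable_scaleR[OF assms(2), of "-1"]] by simp

lemma norm2_scaleR: "norm2 M (\<lambda>x. c *\<^sub>R f x) = \<bar>c\<bar> * norm2 M f"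
  by (simp add: norm2_def power_mult_distrib real_sqrt_mult)

lemma norm2_cong_AE:
  assumes "sq_integrable M f" "sq_integrable M g" "AE x in M. f x = g x"
  shows "norm2 M f = norm2 M g"
  unfolding norm2_def
  by (rule arg_cong[where f=sqrt], rule integral_cong_AE)
     (use assms in \<open>auto simp: sq_integrable_def elim: eventually_mono\<close>)

text \<open>The quadratic expansion behind both the Cauchy-Schwarz and the triangle inequality
  below.\<close>

lemma norm2_linear_combination_power2:
  assumes f: "sq_integrable M f" and g: "sq_integrable M g"
  shows "(norm2 M (\<lambda>x. a *\<^sub>R f x + b *\<^sub>R g x))\<^sup>2
    = a\<^sup>2 * (norm2 M f)\<^sup>2 + b\<^sup>2 * (norm2 M g)\<^sup>2 + 2 * a * b * (\<integral>x. f x \<bullet> g x \<partial>M)"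
proof -
  have "(norm (a *\<^sub>R f x + b *\<^sub>R g x))\<^sup>2
      = a\<^sup>2 * (norm (f x))\<^sup>2 + b\<^sup>2 * (norm (g x))\<^sup>2 + 2 * a * b * (f x \<bullet> g x)" for x
    unfolding power2_norm_eq_inner
    by (simp add: inner_add_left inner_add_right inner_commute[of "g x" "f x"] power2_eq_square algebra_simps)
  then show ?thesis
    using f g sq_integrable_inner[OF f g]
    by (simp add: norm2_power2 sq_integrable_def)
qed

lemma Cauchy_Schwarz_norm2:
  assumes f: "sq_integrable M f" and g: "sq_integrable M g"
  shows "\<bar>\<integral>x. f x \<bullet> g x \<partial>M\<bar> \<le> norm2 M f * norm2 M g"
proof -
  define a where "a = (norm2 M f)\<^sup>2"
  define c where "c = (norm2 M g)\<^sup>2"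
  define b where "b = (\<integral>x. f x \<bullet> g x \<partial>M)"
  have "b\<^sup>2 \<le> a * c"
  proof (cases "a = 0")
    case True
    then have "AE x in M. (norm (f x))\<^sup>2 = 0"
      using f integral_nonneg_eq_0_iff_AE[of M "\<lambda>x. (norm (f x))\<^sup>2"]
      by (simp add: a_def norm2_power2 sq_integrable_def del: power_eq_0_iff zero_eq_power2)
    then have "AE x in M. f x \<bullet> g x = 0"
      by (auto elim: eventually_mono)
    then have "b = (\<integral>x. 0 \<partial>M)"
      unfolding b_def using f g by (intro integral_cong_AE) (auto simp: sq_integrable_def)
    then show ?thesis by (simp add: a_def c_def)
  next
    case False
    then have pos: "a > 0" by (simp add: a_def)
    \<comment> \<open>The discriminant argument without division: with \<open>a\<close> the squared
      norm of f, the combination \<open>- b\<close> f + \<open>a\<close> g has squared norm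
      \<open>a * (a * c - b\<^sup>2)\<close>. It says nothing when \<open>a = 0\<close>, hence the
      separate case, in which f vanishes almost everywhere.\<close>
    have "0 \<le> (norm2 M (\<lambda>x. (- b) *\<^sub>R f x + a *\<^sub>R g x))\<^sup>2" by simp
    also have "\<dots> = (- b)\<^sup>2 * a + a\<^sup>2 * c + 2 * (- b) * a * b"
      by (simp only: norm2_linear_combination_power2[OF f g] a_def b_def c_def)
    also have "\<dots> = a * (a * c - b\<^sup>2)"
      by (simp add: power2_eq_square algebra_simps)
    finally show ?thesis using pos by (simp add: zero_le_mult_iff)
  qed
  then have "sqrt (b\<^sup>2) \<le> sqrt (a * c)" by (rule real_sqrt_le_mono)
  then show ?thesis
    by (simp add: a_def c_def b_def real_sqrt_mult norm2_nonneg)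
qed

lemma norm2_triangle:
  assumes f: "sq_integrable M f" and g: "sq_integrable M g"
  shows "norm2 M (\<lambda>x. f x + g x) \<le> norm2 M f + norm2 M g"
proof -
  have "(norm2 M (\<lambda>x. f x + g x))\<^sup>2
      = (norm2 M f)\<^sup>2 + (norm2 M g)\<^sup>2 + 2 * (\<integral>x. f x \<bullet> g x \<partial>M)"
    using norm2_linear_combination_power2[OF f g, of 1 1] by simp
  also have "\<dots> \<le> (norm2 M f + norm2 M g)\<^sup>2"
    using Cauchy_Schwarz_norm2[OF f g] by (simp add: power2_sum)
  finally show ?thesis
    by (rule power2_le_imp_le) (simp add: norm2_nonneg)
qed

lemma norm2_triangle_diff:
  assumes f: "sq_integrable M f" and g: "sq_integrable M g"
  shows "\<bar>norm2 M f - norm2 M g\<bar> \<le> norm2 M (\<lambda>x. f x - g x)"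
proof -
  have "norm2 M f \<le> norm2 M (\<lambda>x. f x - g x) + norm2 M g"
    using norm2_triangle[OF sq_integrable_diff[OF f g] g] by simp
  moreover have "norm2 M g \<le> norm2 M (\<lambda>x. g x - f x) + norm2 M f"
    using norm2_triangle[OF sq_integrable_diff[OF g f] f] by simp
  moreover have "norm2 M (\<lambda>x. g x - f x) = norm2 M (\<lambda>x. f x - g x)"
    by (simp add: norm2_def norm_minus_commute)
  ultimately show ?thesis by linarith
qed

lemma norm2_tendsto:
  assumes "\<And>n. sq_integrable M (f n)" "sq_integrable M g"
    and "((\<lambda>n. norm2 M (\<lambda>x. f n x - g x)) \<longlongrightarrow> 0) F"
  shows "((\<lambda>n. norm2 M (f n)) \<longlongrightarrow> norm2 M g) F"
proof (rule LIM_zero_cancel, rule tendsto_rabs_zero_cancel)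
  show "((\<lambda>n. \<bar>norm2 M (f n) - norm2 M g\<bar>) \<longlongrightarrow> 0) F"
    by (rule tendsto_sandwich[OF _ _ tendsto_const assms(3)])
       (auto intro!: always_eventually norm2_triangle_diff assms)
qed

lemma sq_integrable_bounded:
  assumes "finite_measure M" "f \<in> borel_measurable M" "AE x in M. norm (f x) \<le> B"
  shows "sq_integrable M f"
proof -
  have "AE x in M. norm ((norm (f x))\<^sup>2) \<le> B\<^sup>2"
    using assms(3) by (auto elim!: eventually_mono intro: power_mono)
  then have "integrable M (\<lambda>x. (norm (f x))\<^sup>2)"
    using assms(2) by (intro finite_measure.integrable_const_bound[OF assms(1)]) auto
  with assms(2) show ?thesis by (simp add: sq_integrable_def)
qed

text \<open>The pointwise bound \<open>t \<le> 1 + t\<^sup>2\<close> suffices, since constants are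
  integrable for a finite measure.\<close>

lemma sq_integrable_imp_integrable:
  fixes f :: "'m \<Rightarrow> 'b::euclidean_space"
  assumes fin: "finite_measure M" and f: "sq_integrable M f"
  shows "integrable M f"
proof (rule Bochner_Integration.integrable_bound)
  show "integrable M (\<lambda>x. 1 + (norm (f x))\<^sup>2)"
    using f fin by (intro Bochner_Integration.integrable_add)
       (auto simp: sq_integrable_def intro: finite_measure.integrable_const)
  have "t \<le> 1 + t\<^sup>2" for t :: real
  proof -
    have "2 * t * 1 \<le> t\<^sup>2 + 1\<^sup>2" by (rule sum_squares_bound)
    moreover have "0 \<le> t\<^sup>2" by simp
    ultimately show ?thesis unfolding power_one by linarith
  qed
  then show "AE x in M. norm (f x) \<le> norm (1 + (norm (f x))\<^sup>2)"
    by (auto intro!: AE_I2)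
qed (use f in \<open>simp add: sq_integrable_def\<close>)

subsection \<open>Smooth bump functions\<close>

text \<open>This is exp(-1/t) / t^n, extended by zero. The powers of 1/t are included because
  differentiation produces them: the linear span of the family is closed under derivatives, which
  exp(-1/t) alone is not.\<close>

definition flat :: "nat \<Rightarrow> real \<Rightarrow> real" where
  "flat n t = (if t > 0 then exp (- inverse t) * inverse t ^ n else 0)"

lemma flat_has_derivative:
  "(flat n has_real_derivative (flat (n + 2) t - of_nat n * flat (n + 1) t)) (at t)"
proof (cases t "0::real" rule: linorder_cases)
  case less
  have "((\<lambda>_. 0) has_real_derivative 0) (at t)" by simp
  then have "(flat n has_real_derivative 0) (at t)"
    by (rule has_field_derivative_transform_within_open[where S="{..<0}"])
       (use less in \<open>auto simp: flat_def\<close>)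
  then show ?thesis using less by (simp add: flat_def)
next
  case greater
  have "((\<lambda>s. exp (- inverse s) * inverse s ^ n) has_real_derivative
      (flat (n + 2) t - of_nat n * flat (n + 1) t)) (at t)"
  proof -
    have "((\<lambda>s. exp (- inverse s) * inverse s ^ n) has_real_derivative
        exp (- inverse t) * (inverse t)\<^sup>2 * inverse t ^ n
          - exp (- inverse t) * (of_nat n * inverse t ^ (n - 1) * (inverse t)\<^sup>2)) (at t)"
      using greater by (auto intro!: derivative_eq_intros simp: power2_eq_square)
    also have "exp (- inverse t) * (inverse t)\<^sup>2 * inverse t ^ n
          - exp (- inverse t) * (of_nat n * inverse t ^ (n - 1) * (inverse t)\<^sup>2)
        = flat (n + 2) t - of_nat n * flat (n + 1) t"
      \<comment> \<open>For n = 0 the exponent \<open>n - 1\<close> is truncated, but its factor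
        \<open>of_nat n\<close> is then zero.\<close>
      using greater by (cases n) (simp_all add: flat_def power2_eq_square)
    finally show ?thesis .
  qed
  then show ?thesis
    by (rule has_field_derivative_transform_within_open[where S="{0<..}"])
       (use greater in \<open>auto simp: flat_def\<close>)
next
  case equal
  \<comment> \<open>With x = 1/h, the right difference quotient of \<open>flat n\<close> at 0
    becomes x^(n+1) / exp x. The left one is identically zero.\<close>
  have "((\<lambda>x::real. x ^ Suc n / exp x) \<longlongrightarrow> 0) at_top"
    by (rule tendsto_power_div_exp_0)
  then have "((\<lambda>h::real. inverse h ^ Suc n / exp (inverse h)) \<longlongrightarrow> 0) (at_right 0)"
    by (rule filterlim_compose) (rule filterlim_inverse_at_top_right)
  moreover have "eventually (\<lambda>h::real. inverse h ^ Suc n / exp (inverse h) = (flat n (0 + h) - flat n 0) / h) (at_right 0)"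
    by (rule eventually_mono[OF eventually_at_right_less])
       (simp add: flat_def exp_minus divide_inverse mult_ac)
  ultimately have R: "((\<lambda>h. (flat n (0 + h) - flat n 0) / h) \<longlongrightarrow> 0) (at_right 0)"
    by (rule Lim_transform_eventually)
  have "eventually (\<lambda>h::real. 0 = (flat n (0 + h) - flat n 0) / h) (at_left 0)"
    by (auto simp: eventually_at_left_field flat_def intro!: exI[of _ "-1"])
  then have L: "((\<lambda>h. (flat n (0 + h) - flat n 0) / h) \<longlongrightarrow> 0) (at_left 0)"
    by (rule Lim_transform_eventually[rotated]) simp
  from L R have "(flat n has_real_derivative 0) (at 0)"
    unfolding DERIV_def by (simp add: filterlim_split_at)
  then show ?thesis using equal by (simp add: flat_def)
qed

text \<open>An algebra generated by one-dimensional profiles along directions v. It is closed under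
  all partial derivatives, and this single closure property yields \<open>Ck_on\<close> of every
  order by induction, without ever computing a higher derivative.\<close>

inductive flat_algebra :: "('a::euclidean_space \<Rightarrow> real) \<Rightarrow> bool" where
  flat: "flat_algebra (\<lambda>x. flat n (c + x \<bullet> v))"
| const: "flat_algebra (\<lambda>x. c)"
| add: "flat_algebra f \<Longrightarrow> flat_algebra g \<Longrightarrow> flat_algebra (\<lambda>x. f x + g x)"
| mult: "flat_algebra f \<Longrightarrow> flat_algebra g \<Longrightarrow> flat_algebra (\<lambda>x. f x * g x)"

lemma flat_algebra_derivative:
  assumes "flat_algebra f"
  shows "\<exists>D. (\<forall>x. (f has_derivative D x) (at x)) \<and> (\<forall>i. flat_algebra (\<lambda>x. D x i))"
  using assms
proof induction
  case (flat n c v)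
  let ?d = "\<lambda>t. flat (n + 2) t - of_nat n * flat (n + 1) t"
  have "((\<lambda>x. flat n (c + x \<bullet> v)) has_derivative (\<lambda>h. (h \<bullet> v) * ?d (c + x \<bullet> v))) (at x)" for x
  proof -
    have "((\<lambda>x. c + x \<bullet> v) has_derivative (\<lambda>h. h \<bullet> v)) (at x)"
      by (auto intro!: derivative_eq_intros)
    from has_derivative_compose[OF this flat_has_derivative[unfolded has_field_derivative_def]]
    show ?thesis by (simp add: mult.commute)
  qed
  moreover have "flat_algebra (\<lambda>x. (h \<bullet> v) * ?d (c + x \<bullet> v))" for h
  proof -
    have "flat_algebra (\<lambda>x. (h \<bullet> v) * (flat (n + 2) (c + x \<bullet> v) + (- of_nat n) * flat (n + 1) (c + x \<bullet> v)))"
      by (intro flat_algebra.intros)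
    then show ?thesis by simp
  qed
  ultimately show ?case by (intro exI[of _ "\<lambda>x h. (h \<bullet> v) * ?d (c + x \<bullet> v)"]) blast
next
  case (const c)
  show ?case
    by (rule exI[of _ "\<lambda>x h. 0"]) (auto intro: flat_algebra.const)
next
  case (add f g)
  then obtain D E where "\<forall>x. (f has_derivative D x) (at x)" "\<forall>i. flat_algebra (\<lambda>x. D x i)"
    "\<forall>x. (g has_derivative E x) (at x)" "\<forall>i. flat_algebra (\<lambda>x. E x i)" by blast
  then show ?case
    by (intro exI[of _ "\<lambda>x h. D x h + E x h"]) (auto intro!: flat_algebra.intros has_derivative_add)
next
  case (mult f g)
  then obtain D E where "\<forall>x. (f has_derivative D x) (at x)" "\<forall>i. flat_algebra (\<lambda>x. D x i)"
    "\<forall>x. (g has_derivative E x) (at x)" "\<forall>i. flat_algebra (\<lambda>x. E x i)" by blast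
  with mult.hyps show ?case
    by (intro exI[of _ "\<lambda>x h. f x * E x h + D x h * g x"])
       (auto intro!: flat_algebra.intros has_derivative_mult)
qed

lemma flat_algebra_Ck_on: "flat_algebra f \<Longrightarrow> Ck_on k UNIV f"
proof (induction k arbitrary: f)
  case 0
  from flat_algebra_derivative[OF 0] show ?case
    by (auto intro!: continuous_at_imp_continuous_on intro: has_derivative_continuous)
next
  case (Suc k)
  from flat_algebra_derivative[OF Suc.prems] obtain D
    where D: "\<And>x. (f has_derivative D x) (at x)" "\<And>i. flat_algebra (\<lambda>x. D x i)" by blast
  have "frechet_derivative f (at x) = D x" for x
    using D(1) frechet_derivative_at by metis
  then show ?case
    using D Suc.IH
    by (auto intro!: continuous_at_imp_continuous_on has_derivative_continuous
        simp: differentiable_on_def differentiable_def)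
qed

lemma flat_algebra_smooth_on: "flat_algebra f \<Longrightarrow> smooth_on UNIV f"
  by (simp add: smooth_on_def flat_algebra_Ck_on)

lemma flat_algebra_prod:
  assumes "finite A" "\<And>i. i \<in> A \<Longrightarrow> flat_algebra (f i)"
  shows "flat_algebra (\<lambda>x. \<Prod>i\<in>A. f i x)"
  using assms by (induction A) (auto intro: flat_algebra.intros)

lemma flat_algebra_power: "flat_algebra f \<Longrightarrow> flat_algebra (\<lambda>x. f x ^ n)"
  by (induction n) (auto intro: flat_algebra.intros)

lemma flat_0_bounds: "0 \<le> flat 0 t" "flat 0 t \<le> 1" "flat 0 t > 0 \<longleftrightarrow> t > 0"
  by (auto simp: flat_def)

lemma box_bump:
  fixes a b :: "'a::euclidean_space"
  obtains \<phi> where "flat_algebra \<phi>" "\<And>x. 0 \<le> \<phi> x" "\<And>x. \<phi> x \<le> 1" "\<And>x. \<phi> x > 0 \<longleftrightarrow> x \<in> box a b"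
proof
  \<comment> \<open>A product of profiles in x_i - a_i and b_i - x_i. Both are spelled as a constant
    plus an inner product with x, the shape of the generators of \<open>flat_algebra\<close>; the
    upper bound 1 holds because exp(-1/t) is at most 1.\<close>
  define \<phi> where "\<phi> x = (\<Prod>i\<in>Basis. flat 0 (- (a \<bullet> i) + x \<bullet> i) * flat 0 (b \<bullet> i + x \<bullet> (- i)))" for x :: 'a
  show "flat_algebra \<phi>"
    unfolding \<phi>_def by (intro flat_algebra_prod flat_algebra.intros) auto
  show nn: "0 \<le> \<phi> x" for x
    unfolding \<phi>_def by (intro prod_nonneg) (auto simp: flat_0_bounds)
  show "\<phi> x \<le> 1" for x
    unfolding \<phi>_def by (intro prod_le_1) (auto simp: flat_0_bounds intro: mult_le_one)
  show "\<phi> x > 0 \<longleftrightarrow> x \<in> box a b" for x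
  proof -
    have "\<phi> x > 0 \<longleftrightarrow> \<phi> x \<noteq> 0" using nn[of x] by auto
    also have "\<dots> \<longleftrightarrow> (\<forall>i\<in>Basis. flat 0 (- (a \<bullet> i) + x \<bullet> i) > 0 \<and> flat 0 (b \<bullet> i + x \<bullet> (- i)) > 0)"
      unfolding \<phi>_def using flat_0_bounds(1) by (auto simp: less_le)
    finally show ?thesis by (auto simp: flat_0_bounds mem_box)
  qed
qed

text \<open>The functions 1 - (1 - \<phi>)^n stay 0 where the bump \<phi> vanishes and tend to 1
  where it is positive. They are polynomials in \<phi>, so they remain in the smooth algebra. Their
  closed supports may reach the boundary of the box, which is why the closed box has to lie in
  \<Omega>.\<close>

lemma indicator_box_limit:
  fixes a b :: "'a::euclidean_space"
  assumes "cbox a b \<subseteq> \<Omega>"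
  obtains \<psi> :: "nat \<Rightarrow> 'a \<Rightarrow> real" where "\<And>n. test_fun \<Omega> (\<psi> n)" "\<And>n x. \<bar>\<psi> n x\<bar> \<le> 1"
    "\<And>x. (\<lambda>n. \<psi> n x) \<longlonglongrightarrow> indicator (box a b) x"
proof -
  obtain \<phi> where \<phi>: "flat_algebra \<phi>" "\<And>x. 0 \<le> \<phi> x" "\<And>x. \<phi> x \<le> 1" "\<And>x. \<phi> x > 0 \<longleftrightarrow> x \<in> box a b"
    using box_bump[of a b] by blast
  define \<psi> where "\<psi> n x = 1 + (- 1) * (1 + (- 1) * \<phi> x) ^ n" for n :: nat and x :: 'a
  have zero: "\<phi> x = 0" if "x \<notin> box a b" for x
    using that \<phi>(2)[of x] \<phi>(4)[of x] by auto
  have "flat_algebra (\<psi> n)" for n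
    unfolding \<psi>_def by (intro flat_algebra.intros flat_algebra_power \<phi>(1))
  moreover have "{x. \<psi> n x \<noteq> 0} \<subseteq> cbox a b" for n
    using zero box_subset_cbox by (force simp: \<psi>_def)
  then have "closure {x. \<psi> n x \<noteq> 0} \<subseteq> cbox a b" for n
    by (rule closure_minimal) (rule closed_cbox)
  moreover from this have "compact (closure {x. \<psi> n x \<noteq> 0})" for n
    by (metis bounded_cbox bounded_subset closed_closure compact_eq_bounded_closed)
  ultimately have "test_fun \<Omega> (\<psi> n)" for n
    unfolding test_fun_def using assms flat_algebra_smooth_on by blast
  moreover have "\<bar>\<psi> n x\<bar> \<le> 1" for n x
  proof -
    have "0 \<le> (1 - \<phi> x) ^ n" "(1 - \<phi> x) ^ n \<le> 1"
      using \<phi>(2,3)[of x] by (auto intro: power_le_one)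
    then show ?thesis by (simp add: \<psi>_def)
  qed
  moreover have "(\<lambda>n. \<psi> n x) \<longlonglongrightarrow> indicator (box a b) x" for x
  proof (cases "x \<in> box a b")
    case True
    then have "\<bar>1 - \<phi> x\<bar> < 1" using \<phi>(3)[of x] \<phi>(4)[of x] by auto
    then have "(\<lambda>n. 1 - (1 - \<phi> x) ^ n) \<longlonglongrightarrow> 1 - 0"
      by (intro tendsto_diff tendsto_const LIMSEQ_power_zero) simp
    with True show ?thesis by (simp add: \<psi>_def)
  next
    case False
    then show ?thesis using zero by (simp add: \<psi>_def)
  qed
  ultimately show thesis using that by blast
qed

text \<open>Open boxes are an intersection-stable generator of the Borel sets, so the vanishing of
  integrals spreads to all Borel sets. Complements require the integral over the whole space to
  vanish, which is why f is zero off one box. In the hypothesis on integrals the inclusion of closed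
  boxes does not follow from that of open ones, since an open box may be empty while its closed
  counterpart is not.\<close>

lemma AE_zero_of_box_integrals_zero:
  fixes f :: "'a::euclidean_space \<Rightarrow> real"
  assumes f: "integrable lborel f"
    and outside: "\<And>x. x \<notin> box a b \<Longrightarrow> f x = 0"
    and zero: "\<And>c d. box c d \<subseteq> box a b \<Longrightarrow> cbox c d \<subseteq> cbox a b \<Longrightarrow> (LINT x:box c d|lborel. f x) = 0"
  shows "AE x in lborel. f x = 0"
proof (rule sigma_finite_measure.density_zero[OF sigma_finite_lborel f])
  have [measurable]: "f \<in> borel_measurable borel" using f by auto
  have si: "set_integrable lborel A f" if "A \<in> sets borel" for A
    using that f integrable_mult_indicator[of A lborel f] by (simp add: set_integrable_def)
  have whole: "(LINT x|lborel. f x) = 0"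
  proof -
    have "(LINT x:box a b|lborel. f x) = 0" by (rule zero) auto
    moreover have "(LINT x:box a b|lborel. f x) = (LINT x|lborel. f x)"
      unfolding set_lebesgue_integral_def
      by (rule Bochner_Integration.integral_cong) (auto simp: indicator_def outside)
    ultimately show ?thesis by simp
  qed
  fix A :: "'a set" assume A: "A \<in> sets lborel"
  have "Int_stable (range (\<lambda>(c, d). box c d :: 'a set))"
    by (auto simp: Int_stable_def box_Int_box)
  moreover have "range (\<lambda>(c, d). box c d :: 'a set) \<subseteq> Pow UNIV" by simp
  moreover from A have "A \<in> sigma_sets UNIV (range (\<lambda>(c, d). box c d :: 'a set))"
    by (simp add: borel_eq_box)
  ultimately show "(LINT x:A|lborel. f x) = 0"
  proof (induction rule: sigma_sets_induct_disjoint)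
    case (basic A)
    then obtain c d where A: "A = box c d" by auto
    \<comment> \<open>Coordinatewise maxima and minima give the corners of the intersection of two
      boxes.\<close>
    define c' d' where "c' = (\<Sum>i\<in>Basis. max (a \<bullet> i) (c \<bullet> i) *\<^sub>R i)"
      and "d' = (\<Sum>i\<in>Basis. min (b \<bullet> i) (d \<bullet> i) *\<^sub>R i)"
    have eq: "box a b \<inter> box c d = box c' d'"
      by (auto simp: mem_box c'_def d'_def)
    have "(LINT x:box c' d'|lborel. f x) = 0"
      by (rule zero) (auto simp: mem_box c'_def d'_def)
    moreover have "(LINT x:box c' d'|lborel. f x) = (LINT x:A|lborel. f x)"
      unfolding set_lebesgue_integral_def A eq[symmetric]
      by (rule Bochner_Integration.integral_cong) (auto simp: indicator_def outside)
    ultimately show ?case by simp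
  next
    case empty
    then show ?case by (simp add: set_lebesgue_integral_def)
  next
    case (compl A)
    then have A: "A \<in> sets borel" by (simp add: borel_eq_box)
    have "(LINT x:UNIV - A|lborel. f x) = (LINT x|lborel. f x - indicator A x *\<^sub>R f x)"
      unfolding set_lebesgue_integral_def
      by (rule Bochner_Integration.integral_cong) (auto simp: indicator_def)
    also have "\<dots> = 0"
      using si[OF A] f whole compl.IH
      by (simp add: set_integrable_def set_lebesgue_integral_def)
    finally show ?case .
  next
    case (union A)
    then have "A i \<in> sets borel" for i by (auto simp: borel_eq_box)
    then have "(LINT x:(\<Union>i. A i)|lborel. f x) = (\<Sum>i. LINT x:A i|lborel. f x)"
      using union.hyps(1) si by (intro lebesgue_integral_countable_add) (auto simp: disjoint_family_on_def)
    with union.IH show ?case by simp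
  qed
qed

subsection \<open>Uniqueness and stability of weak gradients\<close>

lemma open_in_sets_lebesgue: "open S \<Longrightarrow> S \<in> sets lebesgue" for S :: "'a::euclidean_space set"
  by (intro sets_completionI_sets) simp

text \<open>The fundamental lemma of the calculus of variations. Test functions approximate
  indicators of boxes boundedly and pointwise, so dominated convergence turns the hypothesis into
  vanishing integrals over boxes inside \<Omega>.\<close>

lemma AE_zero_of_test_fun_integrals_zero:
  fixes f :: "'a::euclidean_space \<Rightarrow> real"
  assumes op: "open \<Omega>" and f: "integrable (lebesgue_on \<Omega>) f"
    and zero: "\<And>\<phi>. test_fun \<Omega> \<phi> \<Longrightarrow> (\<integral>x. f x * \<phi> x \<partial>lebesgue_on \<Omega>) = 0"
  shows "AE x in lebesgue_on \<Omega>. f x = 0"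
proof -
  have \<Omega>[simp]: "\<Omega> \<in> sets lebesgue" by (rule open_in_sets_lebesgue[OF op])
  define F where "F = (\<lambda>x. indicator \<Omega> x * f x)"
  have F: "integrable lebesgue F"
    using f by (simp add: F_def integrable_restrict_space)
  \<comment> \<open>The box argument lives on \<open>lborel\<close>, while f is only Lebesgue
    measurable; a Borel representative of its extension by zero bridges the two.\<close>
  obtain F' where F'm: "F' \<in> borel_measurable lborel" and F'eq: "AE x in lborel. F x = F' x"
    using completion_ex_borel_measurable_real[OF borel_measurable_integrable[OF F]] by blast
  have F'eq': "AE x in lebesgue. F x = F' x" by (rule AE_completion[OF F'eq])
  have F'i: "integrable lborel F'"
  proof -
    have "integrable lebesgue F'"
      using F F'eq' F'm by (subst integrable_cong_AE[of _ _ F])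
        (auto intro: measurable_completion elim: eventually_mono)
    then show ?thesis using F'm integrable_completion by blast
  qed
  have box0: "(LINT x:box a b|lborel. F' x) = 0" if ab: "cbox a b \<subseteq> \<Omega>" for a b
  proof -
    obtain \<psi> :: "nat \<Rightarrow> 'a \<Rightarrow> real" where \<psi>: "\<And>n. test_fun \<Omega> (\<psi> n)" "\<And>n x. \<bar>\<psi> n x\<bar> \<le> 1"
      "\<And>x. (\<lambda>n. \<psi> n x) \<longlonglongrightarrow> indicator (box a b) x"
      using indicator_box_limit[OF ab] by blast
    have \<psi>m: "\<psi> n \<in> borel_measurable borel" for n
    proof -
      have "Ck_on 0 UNIV (\<psi> n)" using \<psi>(1)[of n] unfolding test_fun_def smooth_on_def by blast
      then show ?thesis by (simp add: borel_measurable_continuous_onI)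
    qed
    have "(\<lambda>n. \<integral>x. \<psi> n x * F' x \<partial>lborel) \<longlonglongrightarrow> (\<integral>x. indicator (box a b) x * F' x \<partial>lborel)"
    proof (rule integral_dominated_convergence[where w = "\<lambda>x. \<bar>F' x\<bar>"])
      show "AE x in lborel. norm (\<psi> n x * F' x) \<le> \<bar>F' x\<bar>" for n
        using mult_right_mono[OF \<psi>(2)] by (auto simp: abs_mult)
    qed (use F'm F'i \<psi>m \<psi>(3) in \<open>auto intro!: tendsto_mult\<close>)
    moreover have "(\<integral>x. \<psi> n x * F' x \<partial>lborel) = 0" for n
    proof -
      have "(\<integral>x. \<psi> n x * F' x \<partial>lborel) = (\<integral>x. \<psi> n x * F' x \<partial>lebesgue)"
        using F'm \<psi>m[of n] by (subst integral_completion) auto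
      also have "\<dots> = (\<integral>x. \<psi> n x * F x \<partial>lebesgue)"
        using F'eq' borel_measurable_integrable[OF F] measurable_completion[OF F'm]
          measurable_completion[of "\<psi> n" lborel borel] \<psi>m[of n]
        by (intro integral_cong_AE borel_measurable_times) (auto elim: eventually_mono)
      also have "\<dots> = (\<integral>x. indicator \<Omega> x *\<^sub>R (f x * \<psi> n x) \<partial>lebesgue)"
        by (rule Bochner_Integration.integral_cong) (simp_all add: F_def)
      also have "\<dots> = (\<integral>x. f x * \<psi> n x \<partial>lebesgue_on \<Omega>)"
        by (rule integral_restrict_space[symmetric]) simp
      finally show ?thesis using zero[OF \<psi>(1)] by simp
    qed
    ultimately have "(\<lambda>n. 0) \<longlonglongrightarrow> (\<integral>x. indicator (box a b) x * F' x \<partial>lborel)"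
      by simp
    then show ?thesis
      unfolding LIMSEQ_const_iff by (simp add: set_lebesgue_integral_def)
  qed
  have cb: "AE x in lborel. x \<in> cbox a b \<longrightarrow> F' x = 0" if ab: "cbox a b \<subseteq> \<Omega>" for a b
  proof -
    have "AE x in lborel. indicator (box a b) x * F' x = 0"
    proof (rule AE_zero_of_box_integrals_zero[of _ a b])
      show "integrable lborel (\<lambda>x. indicator (box a b) x * F' x)"
        using integrable_mult_indicator[OF _ F'i, of "box a b"] by simp
      show "indicator (box a b) x * F' x = 0" if "x \<notin> box a b" for x
        using that by simp
      fix c d assume *: "box c d \<subseteq> box a b" "cbox c d \<subseteq> cbox a b"
      have "(LINT x:box c d|lborel. indicator (box a b) x * F' x) = (LINT x:box c d|lborel. F' x)"
        unfolding set_lebesgue_integral_def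
        by (rule Bochner_Integration.integral_cong) (use * in \<open>auto simp: indicator_def\<close>)
      also have "\<dots> = 0" by (rule box0) (use * ab in blast)
      finally show "(LINT x:box c d|lborel. indicator (box a b) x * F' x) = 0" .
    qed
    moreover have "AE x in lborel. x \<notin> cbox a b - box a b"
    proof -
      have "cbox a b - box a b \<in> null_sets lborel"
        using negligible_frontier_interval[of a b]
        by (simp add: negligible_iff_null_sets null_sets_completion_iff)
      then show ?thesis by (rule AE_not_in)
    qed
    ultimately show ?thesis by eventually_elim (auto simp: indicator_def split: if_splits)
  qed
  \<comment> \<open>An open set is a countable union of closed boxes, so only countably many
    exceptional null sets are collected. Closed boxes cost nothing, their boundary being a null
    set.\<close>
  obtain \<D> where \<D>: "countable \<D>" "\<D> \<subseteq> Pow \<Omega>" "\<And>X. X \<in> \<D> \<Longrightarrow> \<exists>a b. X = cbox a b" "\<Union>\<D> = \<Omega>"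
    using open_countable_Union_open_cbox[OF op] by blast
  have "AE x in lborel. \<forall>X\<in>\<D>. x \<in> X \<longrightarrow> F' x = 0"
    using \<D> cb by (subst AE_ball_countable) (auto, metis PowD subsetD)
  then have "AE x in lebesgue. \<forall>X\<in>\<D>. x \<in> X \<longrightarrow> F' x = 0" by (rule AE_completion)
  with F'eq' have "AE x in lebesgue. x \<in> \<Omega> \<longrightarrow> f x = 0"
    by eventually_elim (use \<D>(4) in \<open>auto simp: F_def indicator_def\<close>)
  then show ?thesis by (simp add: AE_restrict_space_iff)
qed

text \<open>Passing from set integrals to the restricted measure makes the theory of
  \<open>sq_integrable\<close> and \<open>norm2\<close> applicable.\<close>

lemma is_weak_grad_iff:
  assumes "\<Omega> \<in> sets lebesgue"
  shows "is_weak_grad \<Omega> u G \<longleftrightarrow> sq_integrable (lebesgue_on \<Omega>) u \<and> sq_integrable (lebesgue_on \<Omega>) G \<and>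
    (\<forall>\<phi>. test_fun \<Omega> \<phi> \<longrightarrow> (\<forall>i\<in>Basis.
      (\<integral>x. u x * frechet_derivative \<phi> (at x) i \<partial>lebesgue_on \<Omega>) = - (\<integral>x. (G x \<bullet> i) * \<phi> x \<partial>lebesgue_on \<Omega>)))"
proof -
  have I: "set_integrable lebesgue \<Omega> f \<longleftrightarrow> integrable (lebesgue_on \<Omega>) f"
      "set_lebesgue_integral lebesgue \<Omega> f = integral\<^sup>L (lebesgue_on \<Omega>) f" for f :: "'a \<Rightarrow> real"
    using assms
    by (simp_all add: set_integrable_def set_lebesgue_integral_def integrable_restrict_space integral_restrict_space)
  have B: "set_borel_measurable lebesgue \<Omega> f \<longleftrightarrow> f \<in> borel_measurable (lebesgue_on \<Omega>)"
    for f :: "'a \<Rightarrow> 'b::real_normed_vector"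
    using assms by (simp add: set_borel_measurable_def borel_measurable_restrict_space_iff)
  show ?thesis
    unfolding is_weak_grad_def in_L2_def in_L2_vec_def sq_integrable_def I B real_norm_def power2_abs
    by (rule refl)
qed

section \<open>Bounds and integrability of test functions\<close>

lemma test_fun_derivative:
  assumes "test_fun \<Omega> \<phi>"
  shows "(\<phi> has_derivative frechet_derivative \<phi> (at x)) (at x)"
    and "continuous_on UNIV \<phi>"
    and "i \<in> Basis \<Longrightarrow> continuous_on UNIV (\<lambda>x. frechet_derivative \<phi> (at x) i)"
proof -
  have "Ck_on (Suc 0) UNIV \<phi>" using assms unfolding test_fun_def smooth_on_def by blast
  then have C: "continuous_on UNIV \<phi>" "\<phi> differentiable_on UNIV"
    "\<forall>i\<in>Basis. continuous_on UNIV (\<lambda>x. frechet_derivative \<phi> (at x) i)"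
    by simp_all
  then show "continuous_on UNIV \<phi>"
    "i \<in> Basis \<Longrightarrow> continuous_on UNIV (\<lambda>x. frechet_derivative \<phi> (at x) i)"
    by blast+
  from C(2) show "(\<phi> has_derivative frechet_derivative \<phi> (at x)) (at x)"
    by (simp add: differentiable_on_def flip: frechet_derivative_works)
qed

lemma bounded_of_continuous_compact_support:
  fixes f :: "'a::euclidean_space \<Rightarrow> real"
  assumes "continuous_on UNIV f" "compact K" "\<And>x. x \<notin> K \<Longrightarrow> f x = 0"
  obtains B where "\<And>x. \<bar>f x\<bar> \<le> B"
proof -
  have "compact (f ` K)"
    by (rule compact_continuous_image[OF continuous_on_subset[OF assms(1)] assms(2)]) simp
  from compact_imp_bounded[OF this] obtain B where B: "\<And>y. y \<in> f ` K \<Longrightarrow> norm y \<le> B"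
    unfolding bounded_iff by auto
  have "\<bar>f x\<bar> \<le> max B 0" for x
    using B[of "f x"] assms(3)[of x] by (cases "x \<in> K") auto
  then show thesis using that by blast
qed

lemma test_fun_bounds:
  assumes \<phi>: "test_fun \<Omega> \<phi>"
  obtains B where "\<And>x. \<bar>\<phi> x\<bar> \<le> B" "\<And>x i. i \<in> Basis \<Longrightarrow> \<bar>frechet_derivative \<phi> (at x) i\<bar> \<le> B"
proof -
  define K where "K = closure {x. \<phi> x \<noteq> 0}"
  have K: "compact K" using \<phi> by (simp add: test_fun_def K_def)
  have out: "\<phi> x = 0" if "x \<notin> K" for x
    using that closure_subset[of "{x. \<phi> x \<noteq> 0}"] by (auto simp: K_def)
  obtain B0 where B0: "\<And>x. \<bar>\<phi> x\<bar> \<le> B0"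
    using bounded_of_continuous_compact_support[OF test_fun_derivative(2)[OF \<phi>] K out] by blast
  \<comment> \<open>The complement of the support is open and \<phi> vanishes on it, so the
    derivative vanishes there too and compactness bounds it globally.\<close>
  have dout: "frechet_derivative \<phi> (at x) i = 0" if "x \<notin> K" for x i
  proof -
    have "((\<lambda>_. 0) has_derivative (\<lambda>_. 0)) (at x)" by simp
    then have "(\<phi> has_derivative (\<lambda>_. 0)) (at x)"
      by (rule has_derivative_transform_within_open[where s="- K"])
         (use K that out in \<open>auto simp: compact_imp_closed\<close>)
    then show ?thesis by (simp flip: frechet_derivative_at)
  qed
  have "\<exists>B. \<forall>x. \<bar>frechet_derivative \<phi> (at x) i\<bar> \<le> B" if "i \<in> Basis" for i
    using bounded_of_continuous_compact_support[OF test_fun_derivative(3)[OF \<phi> that] K dout] by blast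
  then obtain B1 where B1: "\<And>i x. i \<in> Basis \<Longrightarrow> \<bar>frechet_derivative \<phi> (at x) i\<bar> \<le> B1 i" by metis
  have "\<bar>frechet_derivative \<phi> (at x) i\<bar> \<le> B0 + (\<Sum>j\<in>Basis. \<bar>B1 j\<bar>)" if "i \<in> Basis" for x i
  proof -
    have "\<bar>B1 i\<bar> \<le> (\<Sum>j\<in>Basis. \<bar>B1 j\<bar>)" by (rule member_le_sum) (use that in auto)
    moreover have "B0 \<ge> 0" using B0[of x] by linarith
    ultimately show ?thesis using B1[OF that, of x] by linarith
  qed
  moreover have "\<bar>\<phi> x\<bar> \<le> B0 + (\<Sum>j\<in>Basis. \<bar>B1 j\<bar>)" for x
    using B0[of x] by (intro order_trans[OF B0]) (simp add: sum_nonneg)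
  ultimately show thesis using that by blast
qed

lemma finite_measure_lebesgue_on:
  assumes "open \<Omega>" "bounded \<Omega>"
  shows "finite_measure (lebesgue_on \<Omega>)"
proof -
  have "\<Omega> \<in> lmeasurable" using assms by (simp add: lmeasurable_open)
  then show ?thesis
    by (intro finite_measureI) (simp add: emeasure_restrict_space fmeasurable_def space_restrict_space less_top del: emeasure_completion)
qed

lemma continuous_borel_measurable_lebesgue_on:
  assumes "continuous_on UNIV f"
  shows "f \<in> borel_measurable (lebesgue_on \<Omega>)"
  by (intro measurable_restrict_space1 measurable_completion)
     (simp add: borel_measurable_continuous_onI[OF assms])

lemma test_fun_sq_integrable:
  assumes \<Omega>: "open \<Omega>" "bounded \<Omega>" and \<phi>: "test_fun \<Omega> \<phi>"
  shows "sq_integrable (lebesgue_on \<Omega>) \<phi>"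
    and "i \<in> Basis \<Longrightarrow> sq_integrable (lebesgue_on \<Omega>) (\<lambda>x. frechet_derivative \<phi> (at x) i)"
proof -
  obtain B where B: "\<And>x. \<bar>\<phi> x\<bar> \<le> B" "\<And>x i. i \<in> Basis \<Longrightarrow> \<bar>frechet_derivative \<phi> (at x) i\<bar> \<le> B"
    using test_fun_bounds[OF \<phi>] by blast
  note [intro] = sq_integrable_bounded[OF finite_measure_lebesgue_on[OF \<Omega>], where B=B]
    continuous_borel_measurable_lebesgue_on
  show "sq_integrable (lebesgue_on \<Omega>) \<phi>"
    using B test_fun_derivative(2)[OF \<phi>] by auto
  show "sq_integrable (lebesgue_on \<Omega>) (\<lambda>x. frechet_derivative \<phi> (at x) i)" if "i \<in> Basis"
    using B that test_fun_derivative(3)[OF \<phi> that] by auto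
qed

lemma sq_integrable_component:
  assumes "sq_integrable M G" "i \<in> Basis"
  shows "sq_integrable M (\<lambda>x. G x \<bullet> i)"
  unfolding sq_integrable_def
proof (intro conjI)
  show m: "(\<lambda>x. G x \<bullet> i) \<in> borel_measurable M"
    using assms(1) by (intro borel_measurable_inner) (auto simp: sq_integrable_def)
  show "integrable M (\<lambda>x. (norm (G x \<bullet> i))\<^sup>2)"
  proof (rule Bochner_Integration.integrable_bound)
    show "integrable M (\<lambda>x. (norm (G x))\<^sup>2)" using assms(1) by (simp add: sq_integrable_def)
    show "(\<lambda>x. (norm (G x \<bullet> i))\<^sup>2) \<in> borel_measurable M" using m by measurable
    have "(norm (G x \<bullet> i))\<^sup>2 \<le> (norm (G x))\<^sup>2" for x
      using Basis_le_norm[OF assms(2), of "G x"] by (intro power_mono) auto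
    then show "AE x in M. norm ((norm (G x \<bullet> i))\<^sup>2) \<le> norm ((norm (G x))\<^sup>2)"
      by (intro AE_I2) (simp only: real_norm_def abs_power2)
  qed
qed

text \<open>Each component of the difference integrates to zero against every test function. This
  makes the choice hidden in \<open>wgrad\<close> immaterial for all integrals.\<close>

lemma weak_grad_unique:
  fixes \<Omega> :: "'a::euclidean_space set"
  assumes \<Omega>: "open \<Omega>" "bounded \<Omega>" and G: "is_weak_grad \<Omega> u G" and G': "is_weak_grad \<Omega> u G'"
  shows "AE x in lebesgue_on \<Omega>. G x = G' x"
proof -
  let ?M = "lebesgue_on \<Omega>"
  have [simp]: "\<Omega> \<in> sets lebesgue" by (rule open_in_sets_lebesgue[OF \<Omega>(1)])
  note G = G[unfolded is_weak_grad_iff[OF \<open>\<Omega> \<in> sets lebesgue\<close>]]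
  note G' = G'[unfolded is_weak_grad_iff[OF \<open>\<Omega> \<in> sets lebesgue\<close>]]
  have fin: "finite_measure ?M" by (rule finite_measure_lebesgue_on[OF \<Omega>])
  have "AE x in ?M. (G x \<bullet> i) - (G' x \<bullet> i) = 0" if i: "i \<in> Basis" for i
  proof (rule AE_zero_of_test_fun_integrals_zero[OF \<Omega>(1)])
    have s: "sq_integrable ?M (\<lambda>x. G x \<bullet> i)" "sq_integrable ?M (\<lambda>x. G' x \<bullet> i)"
      using G G' i sq_integrable_component by blast+
    then show "integrable ?M (\<lambda>x. (G x \<bullet> i) - (G' x \<bullet> i))"
      by (intro sq_integrable_imp_integrable[OF fin] sq_integrable_diff)
    fix \<phi> assume \<phi>: "test_fun \<Omega> \<phi>"
    have "integrable ?M (\<lambda>x. (G x \<bullet> i) * \<phi> x)" "integrable ?M (\<lambda>x. (G' x \<bullet> i) * \<phi> x)"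
      using sq_integrable_inner[OF s(1) test_fun_sq_integrable(1)[OF \<Omega> \<phi>]]
        sq_integrable_inner[OF s(2) test_fun_sq_integrable(1)[OF \<Omega> \<phi>]] by simp_all
    then show "(\<integral>x. ((G x \<bullet> i) - (G' x \<bullet> i)) * \<phi> x \<partial>?M) = 0"
      using G G' \<phi> i by (simp add: left_diff_distrib)
  qed
  then have "AE x in ?M. \<forall>i\<in>Basis. (G x \<bullet> i) - (G' x \<bullet> i) = 0"
    by (subst AE_ball_countable) (auto simp: countable_finite)
  then show ?thesis by eventually_elim (simp add: euclidean_eq_iff[where 'a='a])
qed

text \<open>Linearity is stated for the relation and not for \<open>wgrad\<close>, which as an
  arbitrary choice is linear only up to null sets.\<close>

lemma weak_grad_linear_combination:
  fixes \<Omega> :: "'a::euclidean_space set"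
  assumes \<Omega>: "open \<Omega>" "bounded \<Omega>" and G: "is_weak_grad \<Omega> u G" and H: "is_weak_grad \<Omega> v H"
  shows "is_weak_grad \<Omega> (\<lambda>x. a * u x + b * v x) (\<lambda>x. a *\<^sub>R G x + b *\<^sub>R H x)"
proof -
  let ?M = "lebesgue_on \<Omega>"
  have s: "\<Omega> \<in> sets lebesgue" by (rule open_in_sets_lebesgue[OF \<Omega>(1)])
  note G = G[unfolded is_weak_grad_iff[OF s]]
  note H = H[unfolded is_weak_grad_iff[OF s]]
  show ?thesis unfolding is_weak_grad_iff[OF s]
  proof (intro conjI allI impI ballI)
    show "sq_integrable ?M (\<lambda>x. a * u x + b * v x)"
      using sq_integrable_add[OF sq_integrable_scaleR sq_integrable_scaleR, of ?M u v a b] G H by simp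
    show "sq_integrable ?M (\<lambda>x. a *\<^sub>R G x + b *\<^sub>R H x)"
      using sq_integrable_add[OF sq_integrable_scaleR sq_integrable_scaleR, of ?M G H a b] G H by simp
    fix \<phi> and i :: 'a assume \<phi>: "test_fun \<Omega> \<phi>" and i: "i \<in> Basis"
    note t = test_fun_sq_integrable(1)[OF \<Omega> \<phi>] test_fun_sq_integrable(2)[OF \<Omega> \<phi> i]
    have [simp]: "integrable ?M (\<lambda>x. u x * frechet_derivative \<phi> (at x) i)"
      "integrable ?M (\<lambda>x. v x * frechet_derivative \<phi> (at x) i)"
      "integrable ?M (\<lambda>x. (G x \<bullet> i) * \<phi> x)" "integrable ?M (\<lambda>x. (H x \<bullet> i) * \<phi> x)"
      using sq_integrable_inner[OF _ t(2), of u] sq_integrable_inner[OF _ t(2), of v]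
        sq_integrable_inner[OF sq_integrable_component[OF _ i] t(1), of G]
        sq_integrable_inner[OF sq_integrable_component[OF _ i] t(1), of H] G H by simp_all
    have "(\<integral>x. (a * u x + b * v x) * frechet_derivative \<phi> (at x) i \<partial>?M)
        = a * (\<integral>x. u x * frechet_derivative \<phi> (at x) i \<partial>?M) + b * (\<integral>x. v x * frechet_derivative \<phi> (at x) i \<partial>?M)"
      by (simp add: distrib_right mult.assoc)
    moreover have "(\<integral>x. ((a *\<^sub>R G x + b *\<^sub>R H x) \<bullet> i) * \<phi> x \<partial>?M)
        = a * (\<integral>x. (G x \<bullet> i) * \<phi> x \<partial>?M) + b * (\<integral>x. (H x \<bullet> i) * \<phi> x \<partial>?M)"
      by (simp add: distrib_right mult.assoc inner_add_left)
    ultimately show "(\<integral>x. (a * u x + b * v x) * frechet_derivative \<phi> (at x) i \<partial>?M)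
        = - (\<integral>x. ((a *\<^sub>R G x + b *\<^sub>R H x) \<bullet> i) * \<phi> x \<partial>?M)"
      using G H \<phi> i by simp
  qed
qed

text \<open>For a fixed test function both sides of the defining identity are L2 pairings with a
  fixed square-integrable function, hence continuous in u and G by Cauchy-Schwarz.\<close>

lemma weak_grad_closed:
  fixes \<Omega> :: "'a::euclidean_space set"
  assumes \<Omega>: "open \<Omega>" "bounded \<Omega>"
    and u: "sq_integrable (lebesgue_on \<Omega>) u" and G: "sq_integrable (lebesgue_on \<Omega>) G"
    and approx: "\<And>n. is_weak_grad \<Omega> (v n) (g n)"
    and limu: "(\<lambda>n::nat. norm2 (lebesgue_on \<Omega>) (\<lambda>x. u x - v n x)) \<longlonglongrightarrow> 0"
    and limG: "(\<lambda>n. norm2 (lebesgue_on \<Omega>) (\<lambda>x. G x - g n x)) \<longlonglongrightarrow> 0"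
  shows "is_weak_grad \<Omega> u G"
proof -
  let ?M = "lebesgue_on \<Omega>"
  have s: "\<Omega> \<in> sets lebesgue" by (rule open_in_sets_lebesgue[OF \<Omega>(1)])
  have conv: "(\<lambda>n. \<integral>x. f n x \<bullet> w x \<partial>?M) \<longlonglongrightarrow> (\<integral>x. h x \<bullet> w x \<partial>?M)"
    if f: "\<And>n. sq_integrable ?M (f n)" and h: "sq_integrable ?M h" and w: "sq_integrable ?M w"
      and lim: "(\<lambda>n. norm2 ?M (\<lambda>x. h x - f n x)) \<longlonglongrightarrow> 0"
    for f :: "nat \<Rightarrow> 'a \<Rightarrow> 'b::euclidean_space" and h w
  proof (rule LIM_zero_cancel, rule Lim_null_comparison)
    show "(\<lambda>n. norm2 ?M (\<lambda>x. h x - f n x) * norm2 ?M w) \<longlonglongrightarrow> 0"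
      using tendsto_mult_right[OF lim, of "norm2 ?M w"] by simp
    have "norm ((\<integral>x. f n x \<bullet> w x \<partial>?M) - (\<integral>x. h x \<bullet> w x \<partial>?M)) \<le> norm2 ?M (\<lambda>x. h x - f n x) * norm2 ?M w" for n
      using Cauchy_Schwarz_norm2[OF sq_integrable_diff[OF h f] w, of n]
        sq_integrable_inner[OF h w] sq_integrable_inner[OF f w, of n]
      by (simp add: inner_diff_left abs_minus_commute)
    then show "\<forall>\<^sub>F n in sequentially. norm ((\<integral>x. f n x \<bullet> w x \<partial>?M) - (\<integral>x. h x \<bullet> w x \<partial>?M))
        \<le> norm2 ?M (\<lambda>x. h x - f n x) * norm2 ?M w" by simp
  qed
  note a = approx[unfolded is_weak_grad_iff[OF s]]
  show ?thesis unfolding is_weak_grad_iff[OF s]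
  proof (intro conjI allI impI ballI u G)
    fix \<phi> and i :: 'a assume \<phi>: "test_fun \<Omega> \<phi>" and i: "i \<in> Basis"
    note t = test_fun_sq_integrable(1)[OF \<Omega> \<phi>] test_fun_sq_integrable(2)[OF \<Omega> \<phi> i]
    \<comment> \<open>Writing the pairing of a component of G with \<phi> as a vector pairing with
      \<phi> times the basis vector lets \<open>conv\<close> serve gradients as well as
      functions.\<close>
    have ti: "sq_integrable ?M (\<lambda>x. \<phi> x *\<^sub>R i)"
      using t(1) i by (auto simp: sq_integrable_def)
    have "(\<lambda>n. \<integral>x. v n x \<bullet> frechet_derivative \<phi> (at x) i \<partial>?M)
        \<longlonglongrightarrow> (\<integral>x. u x \<bullet> frechet_derivative \<phi> (at x) i \<partial>?M)"
      by (rule conv[OF _ u t(2) limu]) (use a in blast)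
    moreover have "(\<lambda>n. \<integral>x. g n x \<bullet> (\<phi> x *\<^sub>R i) \<partial>?M) \<longlonglongrightarrow> (\<integral>x. G x \<bullet> (\<phi> x *\<^sub>R i) \<partial>?M)"
      by (rule conv[OF _ G ti limG]) (use a in blast)
    then have "(\<lambda>n. - (\<integral>x. g n x \<bullet> (\<phi> x *\<^sub>R i) \<partial>?M)) \<longlonglongrightarrow> - (\<integral>x. G x \<bullet> (\<phi> x *\<^sub>R i) \<partial>?M)"
      by (rule tendsto_minus)
    moreover have "(\<integral>x. v n x \<bullet> frechet_derivative \<phi> (at x) i \<partial>?M) = - (\<integral>x. g n x \<bullet> (\<phi> x *\<^sub>R i) \<partial>?M)" for n
      using a[of n] \<phi> i by (simp add: mult.commute)
    ultimately show "(\<integral>x. u x * frechet_derivative \<phi> (at x) i \<partial>?M) = - (\<integral>x. (G x \<bullet> i) * \<phi> x \<partial>?M)"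
      using LIMSEQ_unique by (fastforce simp: mult.commute)
  qed
qed

subsection \<open>Weak gradients of locally Lipschitz functions\<close>

lemma difference_quotient_tendsto:
  fixes f :: "'a::euclidean_space \<Rightarrow> real"
  assumes "(f has_derivative D) (at x)"
  shows "((\<lambda>t. (f (x + t *\<^sub>R h) - f x) / t) \<longlongrightarrow> D h) (at 0)"
proof -
  have "((\<lambda>t::real. x + t *\<^sub>R h) has_derivative (\<lambda>t. t *\<^sub>R h)) (at 0)"
    by (auto intro!: derivative_eq_intros)
  from has_derivative_compose[OF this, of f D] assms
  have "((\<lambda>t. f (x + t *\<^sub>R h)) has_derivative (\<lambda>t. D (t *\<^sub>R h))) (at 0)"
    by simp
  moreover have "(\<lambda>t. D (t *\<^sub>R h)) = (*) (D h)"
    using has_derivative_linear[OF assms] by (auto simp: linear_scale mult.commute)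
  ultimately have "((\<lambda>t. f (x + t *\<^sub>R h)) has_real_derivative D h) (at 0)"
    by (simp add: has_field_derivative_def)
  then show ?thesis by (simp add: DERIV_def)
qed

lemma lborel_integral_translation:
  fixes g :: "'a::euclidean_space \<Rightarrow> real"
  assumes "g \<in> borel_measurable borel"
  shows "(\<integral>x. g (c + x) \<partial>lborel) = (\<integral>x. g x \<partial>lborel)"
proof -
  have "(\<integral>x. g x \<partial>distr lborel borel ((+) c)) = (\<integral>x. g (c + x) \<partial>lborel)"
    by (rule integral_distr) (use assms in auto)
  then show ?thesis by (simp add: lborel_distr_plus)
qed

lemma directional_derivative_bound:
  fixes f :: "'a::euclidean_space \<Rightarrow> real"
  assumes f: "(f has_derivative D) (at x)"
    and r: "r > 0" and lip: "\<And>y z. y \<in> ball x r \<Longrightarrow> z \<in> ball x r \<Longrightarrow> \<bar>f y - f z\<bar> \<le> L * dist y z"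
  shows "\<bar>D h\<bar> \<le> L * norm h"
proof (rule tendsto_upperbound[OF tendsto_rabs[OF difference_quotient_tendsto[OF f]]])
  have "((\<lambda>t::real. x + t *\<^sub>R h) \<longlongrightarrow> x + 0 *\<^sub>R h) (at 0)" by (intro tendsto_intros)
  then have "eventually (\<lambda>t::real. x + t *\<^sub>R h \<in> ball x r) (at 0)"
    by (rule topological_tendstoD) (use r in auto)
  moreover have "eventually (\<lambda>t::real. t \<noteq> 0) (at 0)" by (simp add: eventually_at_filter)
  ultimately show "eventually (\<lambda>t. \<bar>(f (x + t *\<^sub>R h) - f x) / t\<bar> \<le> L * norm h) (at 0)"
  proof eventually_elim
    case (elim t)
    have "\<bar>f (x + t *\<^sub>R h) - f x\<bar> \<le> L * dist (x + t *\<^sub>R h) x"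
      by (rule lip) (use elim r in auto)
    also have "\<dots> = L * norm h * \<bar>t\<bar>" by (simp add: dist_norm mult_ac)
    finally show ?case using elim by (simp add: abs_divide divide_le_eq)
  qed
qed simp

text \<open>Integration by parts at the level of difference quotients: translation invariance moves
  the quotient from \<phi> to f, and both sides converge by dominated convergence. The Lipschitz
  bound is asked for on small balls only, as \<Omega> need not be convex, but with one constant L,
  which supplies the dominating function. Differentiability almost everywhere is assumed and
  identifies the limit.\<close>

lemma weak_grad_of_locally_Lipschitz:
  fixes f :: "'a::euclidean_space \<Rightarrow> real"
  assumes \<Omega>: "open \<Omega>" "bounded \<Omega>"
    and B: "\<And>x. x \<in> \<Omega> \<Longrightarrow> \<bar>f x\<bar> \<le> B"
    and lip: "\<And>x. x \<in> \<Omega> \<Longrightarrow> \<exists>r>0. ball x r \<subseteq> \<Omega> \<and> (\<forall>y\<in>ball x r. \<forall>z\<in>ball x r. \<bar>f y - f z\<bar> \<le> L * dist y z)"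
    and deriv: "AE x in lebesgue_on \<Omega>. (f has_derivative (\<lambda>h. G x \<bullet> h)) (at x)"
  shows "is_weak_grad \<Omega> f G"
proof -
  let ?M = "lebesgue_on \<Omega>"
  have s[simp]: "\<Omega> \<in> sets lebesgue" by (rule open_in_sets_lebesgue[OF \<Omega>(1)])
  have fin: "finite_measure ?M" by (rule finite_measure_lebesgue_on[OF \<Omega>])
  \<comment> \<open>Extension by zero makes translates meaningful everywhere. Its jump at the
    boundary of \<Omega> does no harm, because quotients of F are evaluated only near the compact
    support of the test function.\<close>
  define F where "F = (\<lambda>x. indicator \<Omega> x * f x)"
  have Fin: "F x = f x" if "x \<in> \<Omega>" for x using that by (simp add: F_def)
  have cont: "continuous_on \<Omega> f"
  proof (rule continuous_at_imp_continuous_on, rule ballI)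
    fix x assume "x \<in> \<Omega>"
    from lip[OF this] obtain r where r: "r > 0" "\<And>y. y \<in> ball x r \<Longrightarrow> \<bar>f y - f x\<bar> \<le> L * dist y x"
      by (metis centre_in_ball)
    have "(f \<longlongrightarrow> f x) (at x)"
    proof (rule LIM_zero_cancel, rule Lim_null_comparison)
      have "((\<lambda>y. L * dist y x) \<longlongrightarrow> L * dist x x) (at x)" by (intro tendsto_intros)
      then show "((\<lambda>y. L * dist y x) \<longlongrightarrow> 0) (at x)" by simp
      show "eventually (\<lambda>y. norm (f y - f x) \<le> L * dist y x) (at x)"
        unfolding eventually_at using r by (auto simp: dist_commute intro!: exI[of _ r])
    qed
    then show "isCont f x" by (simp add: continuous_at)
  qed
  have Fm: "F \<in> borel_measurable borel"
    using borel_measurable_continuous_on_indicator[OF _ cont] \<Omega>(1) by (simp add: F_def)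
  have FB: "\<bar>F x\<bar> \<le> \<bar>B\<bar> * indicator \<Omega> x" for x
    using B[of x] by (auto simp: F_def indicator_def)
  have Fi: "integrable lborel (\<lambda>x. F x * g x)"
    if g: "g \<in> borel_measurable borel" "\<And>x. \<bar>g x\<bar> \<le> C" for g :: "'a \<Rightarrow> real" and C
  proof (rule Bochner_Integration.integrable_bound)
    show "integrable lborel (\<lambda>x. \<bar>B\<bar> * C * indicator \<Omega> x)"
      using \<Omega> emeasure_bounded_finite[OF \<Omega>(2)] by (simp add: less_top)
    show "AE x in lborel. norm (F x * g x) \<le> norm (\<bar>B\<bar> * C * indicator \<Omega> x)"
    proof (intro AE_I2)
      fix x
      have "\<bar>F x\<bar> * \<bar>g x\<bar> \<le> (\<bar>B\<bar> * indicator \<Omega> x) * C"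
        by (intro mult_mono FB g(2)) auto
      also have "\<dots> \<le> \<bar>\<bar>B\<bar> * C * indicator \<Omega> x\<bar>" by (simp add: mult_ac)
      finally show "norm (F x * g x) \<le> norm (\<bar>B\<bar> * C * indicator \<Omega> x)" by (simp add: abs_mult)
    qed
  qed (use Fm g in auto)
  have FD: "(F has_derivative D) (at x)" if "(f has_derivative D) (at x)" "x \<in> \<Omega>" for D x
    by (rule has_derivative_transform_within_open[OF that(1) \<Omega>(1) that(2)]) (simp add: Fin)
  have Dbound: "\<bar>G x \<bullet> h\<bar> \<le> L * norm h"
    if x: "x \<in> \<Omega>" and fx: "(f has_derivative (\<lambda>h. G x \<bullet> h)) (at x)" for x h
  proof -
    obtain r where "r > 0" "\<And>y z. y \<in> ball x r \<Longrightarrow> z \<in> ball x r \<Longrightarrow> \<bar>f y - f z\<bar> \<le> L * dist y z"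
      using lip[OF x] by blast
    from directional_derivative_bound[OF fx this] show ?thesis .
  qed
  have derivL: "AE x in lebesgue. x \<in> \<Omega> \<longrightarrow> (f has_derivative (\<lambda>h. G x \<bullet> h)) (at x)"
    using deriv by (simp add: AE_restrict_space_iff)
  have Gm: "(\<lambda>x. indicator \<Omega> x * (G x \<bullet> i)) \<in> borel_measurable lebesgue" for i
  proof -
    \<comment> \<open>Nothing is assumed about measurability of G. It is obtained from Borel
      difference quotients that converge to G almost everywhere, using completeness of Lebesgue
      measure.\<close>
    define q where "q n x = indicator \<Omega> x * ((F (x + inverse (of_nat (Suc n)) *\<^sub>R i) - F x) / inverse (of_nat (Suc n)))" for n x
    have "q n \<in> borel_measurable borel" for n
    proof -
      have [measurable]: "(\<lambda>x. F (x + c)) \<in> borel_measurable borel" for c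
        by (rule measurable_compose[OF _ Fm]) simp
      note Fm[measurable]
      have [measurable]: "\<Omega> \<in> sets borel" using \<Omega>(1) by simp
      show ?thesis unfolding q_def by measurable
    qed
    then have "(\<lambda>x. lim (\<lambda>n. q n x)) \<in> borel_measurable lebesgue"
      by (intro borel_measurable_lim_metric measurable_completion) simp
    moreover have "AE x in lebesgue. lim (\<lambda>n. q n x) = indicator \<Omega> x * (G x \<bullet> i)"
      using derivL
    proof eventually_elim
      case (elim x)
      have "(\<lambda>n. q n x) \<longlonglongrightarrow> indicator \<Omega> x * (G x \<bullet> i)"
      proof (cases "x \<in> \<Omega>")
        case True
        have "filterlim (\<lambda>n. inverse (of_nat (Suc n)) :: real) (at 0) sequentially"
          by (intro filterlim_atI LIMSEQ_inverse_real_of_nat) simp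
        from filterlim_compose[OF difference_quotient_tendsto[OF FD] this] elim True
        show ?thesis by (simp add: q_def)
      qed (simp add: q_def)
      then show ?case by (rule limI)
    qed
    ultimately show ?thesis by (rule borel_measurable_AE)
  qed
  have Gm': "G \<in> borel_measurable ?M"
  proof (subst borel_measurable_euclidean_space, rule ballI)
    fix i :: 'a assume "i \<in> Basis"
    show "(\<lambda>x. G x \<bullet> i) \<in> borel_measurable ?M"
      using Gm[of i] by (simp add: borel_measurable_restrict_space_iff)
  qed
  have fm': "f \<in> borel_measurable ?M"
  proof -
    have "F \<in> borel_measurable lebesgue" by (rule measurable_completion) (simp add: Fm)
    then have "(\<lambda>x. indicator \<Omega> x *\<^sub>R f x) \<in> borel_measurable lebesgue" by (simp add: F_def)
    then show ?thesis by (subst borel_measurable_restrict_space_iff) simp_all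
  qed
  have "sq_integrable ?M f"
    by (rule sq_integrable_bounded[OF fin fm', of B]) (use B in \<open>simp add: AE_restrict_space_iff\<close>)
  moreover have "sq_integrable ?M G"
  proof (rule sq_integrable_bounded[OF fin Gm', of "\<Sum>i\<in>(Basis::'a set). L"])
    have "AE x in lebesgue. x \<in> \<Omega> \<longrightarrow> norm (G x) \<le> (\<Sum>i\<in>(Basis::'a set). L)"
      using derivL
    proof eventually_elim
      case (elim x)
      show ?case
      proof
        assume x: "x \<in> \<Omega>"
        have "norm (G x) \<le> (\<Sum>i\<in>Basis. \<bar>G x \<bullet> i\<bar>)" by (rule norm_le_l1)
        also have "\<dots> \<le> (\<Sum>i\<in>(Basis::'a set). L)"
        proof (rule sum_mono)
          fix i :: 'a assume "i \<in> Basis"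
          then show "\<bar>G x \<bullet> i\<bar> \<le> L" using Dbound[OF x, of i] elim x by simp
        qed
        finally show "norm (G x) \<le> (\<Sum>i\<in>(Basis::'a set). L)" .
      qed
    qed
    then show "AE x in ?M. norm (G x) \<le> (\<Sum>i\<in>(Basis::'a set). L)"
      by (simp add: AE_restrict_space_iff)
  qed
  moreover have "(\<integral>x. f x * frechet_derivative \<phi> (at x) i \<partial>?M) = - (\<integral>x. (G x \<bullet> i) * \<phi> x \<partial>?M)"
    if \<phi>: "test_fun \<Omega> \<phi>" and i: "i \<in> Basis" for \<phi> i
  proof -
    let ?d = "\<lambda>x. frechet_derivative \<phi> (at x) i"
    obtain C where C: "\<And>x. \<bar>\<phi> x\<bar> \<le> C" "\<And>x i. i \<in> Basis \<Longrightarrow> \<bar>frechet_derivative \<phi> (at x) i\<bar> \<le> C"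
      using test_fun_bounds[OF \<phi>] by blast
    note D = test_fun_derivative(1)[OF \<phi>]
    have \<phi>m: "\<phi> \<in> borel_measurable borel" and dm: "?d \<in> borel_measurable borel"
      using test_fun_derivative(2)[OF \<phi>] test_fun_derivative(3)[OF \<phi> i] borel_measurable_continuous_onI by blast+
    define K where "K = closure {x. \<phi> x \<noteq> 0}"
    have K: "compact K" "K \<subseteq> \<Omega>" using \<phi> by (auto simp: test_fun_def K_def)
    have out: "\<phi> x = 0" if "x \<notin> K" for x
      using that closure_subset[of "{x. \<phi> x \<noteq> 0}"] by (auto simp: K_def)
    \<comment> \<open>The cover of the support by Lipschitz balls has a Lebesgue number e: around
      each point of the support the ball of radius e lies in a single one of them.\<close>
    define \<G> where "\<G> = {ball x r |x r. ball x r \<subseteq> \<Omega> \<and> (\<forall>y\<in>ball x r. \<forall>z\<in>ball x r. \<bar>f y - f z\<bar> \<le> L * dist y z)}"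
    have "K \<subseteq> \<Union>\<G>"
    proof
      fix x assume "x \<in> K"
      with K lip obtain r where "r > 0"
        "ball x r \<subseteq> \<Omega> \<and> (\<forall>y\<in>ball x r. \<forall>z\<in>ball x r. \<bar>f y - f z\<bar> \<le> L * dist y z)" by blast
      then have "ball x r \<in> \<G>" "x \<in> ball x r" by (auto simp: \<G>_def)
      then show "x \<in> \<Union>\<G>" by blast
    qed
    moreover have "open X" if "X \<in> \<G>" for X using that by (auto simp: \<G>_def)
    ultimately obtain e where e: "e > 0" "\<And>x. x \<in> K \<Longrightarrow> \<exists>X\<in>\<G>. ball x e \<subseteq> X"
      using Heine_Borel_lemma[OF K(1)] by metis
    have eL: "\<bar>F y - F x\<bar> \<le> L * dist y x" if "x \<in> K" "dist x y < e" for x y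
    proof -
      from e(2)[OF \<open>x \<in> K\<close>] obtain X where X: "X \<in> \<G>" "ball x e \<subseteq> X" by blast
      have "x \<in> X" "y \<in> X" using X(2) that e(1) by auto
      moreover from X(1) have "X \<subseteq> \<Omega>" "\<And>y z. y \<in> X \<Longrightarrow> z \<in> X \<Longrightarrow> \<bar>f y - f z\<bar> \<le> L * dist y z"
        by (auto simp: \<G>_def)
      ultimately show ?thesis using Fin by (metis subsetD)
    qed
    \<comment> \<open>The denominator n + 2 instead of n + 1 keeps every step strictly below e,
      including the one for n = 0.\<close>
    define t where "t n = e * inverse (of_nat (Suc (Suc n)))" for n
    have t: "t n > 0" "t n < e" for n
    proof -
      show "t n > 0" unfolding t_def using e(1) by (intro mult_pos_pos) auto
      have "inverse (real (Suc (Suc n))) < 1" by (subst inverse_less_1_iff) simp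
      from mult_strict_left_mono[OF this e(1)] show "t n < e" by (simp add: t_def)
    qed
    have t0: "t \<longlonglongrightarrow> 0"
      unfolding t_def using tendsto_mult_right_zero[OF LIMSEQ_Suc[OF LIMSEQ_inverse_real_of_nat]] by simp
    have "\<And>n. - t n \<noteq> 0" "\<And>n. t n \<noteq> 0" using t(1) by (metis less_irrefl neg_equal_0_iff_equal)+
    then have ta: "filterlim t (at 0) sequentially" "filterlim (\<lambda>n. - t n) (at 0) sequentially"
      using t0 tendsto_minus[OF t0] by (auto intro!: filterlim_atI)
    \<comment> \<open>The mean value theorem along the line in direction i writes the quotient as a
      value of the partial derivative, giving a bound uniform in n.\<close>
    have q: "\<bar>(\<phi> (x + t n *\<^sub>R i) - \<phi> x) / t n\<bar> \<le> C" for n x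
    proof -
      have "((\<lambda>s. \<phi> (x + s *\<^sub>R i)) has_real_derivative ?d (x + s *\<^sub>R i)) (at s)" for s
      proof -
        have "((\<lambda>s::real. x + s *\<^sub>R i) has_derivative (\<lambda>s. s *\<^sub>R i)) (at s)"
          by (auto intro!: derivative_eq_intros)
        from has_derivative_compose[OF this D]
        have "((\<lambda>s. \<phi> (x + s *\<^sub>R i)) has_derivative (\<lambda>c. frechet_derivative \<phi> (at (x + s *\<^sub>R i)) (c *\<^sub>R i))) (at s)" .
        moreover have "(\<lambda>c. frechet_derivative \<phi> (at (x + s *\<^sub>R i)) (c *\<^sub>R i)) = (*) (?d (x + s *\<^sub>R i))"
          using has_derivative_linear[OF D] by (auto simp: linear_scale mult.commute)
        ultimately show ?thesis by (simp add: has_field_derivative_def)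
      qed
      from MVT2[OF t(1)[of n] this] obtain z where
        "\<phi> (x + t n *\<^sub>R i) - \<phi> (x + 0 *\<^sub>R i) = (t n - 0) * ?d (x + z *\<^sub>R i)" by blast
      then have "(\<phi> (x + t n *\<^sub>R i) - \<phi> x) / t n = ?d (x + z *\<^sub>R i)"
        using t(1)[of n] by simp
      then show ?thesis using C(2)[OF i] by simp
    qed
    have \<phi>tm: "(\<lambda>x. \<phi> (x + c)) \<in> borel_measurable borel" for c
      by (rule measurable_compose[OF _ \<phi>m]) simp
    have Ftm: "(\<lambda>x. F (x + c)) \<in> borel_measurable borel" for c
      by (rule measurable_compose[OF _ Fm]) simp
    have lim1: "(\<lambda>n. \<integral>x. F x * ((\<phi> (x + t n *\<^sub>R i) - \<phi> x) / t n) \<partial>lborel) \<longlonglongrightarrow> (\<integral>x. F x * ?d x \<partial>lborel)"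
    proof (rule integral_dominated_convergence[where w="\<lambda>x. \<bar>F x * C\<bar>"])
      show "integrable lborel (\<lambda>x. \<bar>F x * C\<bar>)"
        by (intro integrable_abs Fi[of "\<lambda>_. C" "\<bar>C\<bar>"]) auto
      show "AE x in lborel. (\<lambda>n. F x * ((\<phi> (x + t n *\<^sub>R i) - \<phi> x) / t n)) \<longlonglongrightarrow> F x * ?d x"
        by (intro AE_I2 tendsto_mult tendsto_const filterlim_compose[OF difference_quotient_tendsto[OF D] ta(1)])
      show "AE x in lborel. norm (F x * ((\<phi> (x + t n *\<^sub>R i) - \<phi> x) / t n)) \<le> \<bar>F x * C\<bar>" for n
        unfolding real_norm_def abs_mult
        by (intro AE_I2 mult_left_mono order_trans[OF q] abs_ge_self) auto
    qed (use Fm \<phi>m dm \<phi>tm in auto)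
    \<comment> \<open>Discrete integration by parts: substituting x - t i for x turns forward
      quotients of \<phi> into backward quotients of F. The latter, divided by t and not by -t, tend
      to minus the component of G, whence the sign in the weak formulation.\<close>
    have eq1: "(\<integral>x. F x * ((\<phi> (x + t n *\<^sub>R i) - \<phi> x) / t n) \<partial>lborel)
        = (\<integral>x. (F (x + (- t n) *\<^sub>R i) - F x) / t n * \<phi> x \<partial>lborel)" for n
    proof -
      have i1: "integrable lborel (\<lambda>x. F x * \<phi> (x + t n *\<^sub>R i))" "integrable lborel (\<lambda>x. F x * \<phi> x)"
        using Fi[OF \<phi>tm C(1)] Fi[OF \<phi>m C(1)] by auto
      have m: "(\<lambda>x. F (x + (- t n) *\<^sub>R i) * \<phi> x) \<in> borel_measurable borel"
        by (intro borel_measurable_times Ftm \<phi>m)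
      have tr: "(\<integral>x. F (x + (- t n) *\<^sub>R i) * \<phi> x \<partial>lborel) = (\<integral>x. F x * \<phi> (x + t n *\<^sub>R i) \<partial>lborel)"
        using lborel_integral_translation[OF m, of "t n *\<^sub>R i"] by (simp add: add.commute)
      have i2: "integrable lborel (\<lambda>x. F (x + (- t n) *\<^sub>R i) * \<phi> x)"
      proof -
        have "integrable (distr lborel borel ((+) (t n *\<^sub>R i))) (\<lambda>x. F (x + (- t n) *\<^sub>R i) * \<phi> x)"
          using i1(1) by (subst integrable_distr_eq[OF _ m]) (auto simp: add.commute)
        then show ?thesis by (simp add: lborel_distr_plus)
      qed
      have "(\<integral>x. F x * ((\<phi> (x + t n *\<^sub>R i) - \<phi> x) / t n) \<partial>lborel)
          = ((\<integral>x. F x * \<phi> (x + t n *\<^sub>R i) \<partial>lborel) - (\<integral>x. F x * \<phi> x \<partial>lborel)) / t n"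
        using i1 by (simp add: right_diff_distrib)
      also have "\<dots> = (\<integral>x. (F (x + (- t n) *\<^sub>R i) - F x) / t n * \<phi> x \<partial>lborel)"
        using i1 i2 tr by (simp add: left_diff_distrib)
      finally show ?thesis .
    qed
    \<comment> \<open>This limit is taken over \<open>lebesgue\<close> because G is only Lebesgue
      measurable; \<open>eq2\<close> then returns the approximating integrals to
      \<open>lborel\<close>.\<close>
    have lim2: "(\<lambda>n. \<integral>x. (F (x + (- t n) *\<^sub>R i) - F x) / t n * \<phi> x \<partial>lebesgue)
        \<longlonglongrightarrow> (\<integral>x. - (indicator \<Omega> x * (G x \<bullet> i)) * \<phi> x \<partial>lebesgue)"
    proof (rule integral_dominated_convergence[where w="\<lambda>x. \<bar>L\<bar> * C * indicator \<Omega> x"])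
      show "integrable lebesgue (\<lambda>x. \<bar>L\<bar> * C * indicator \<Omega> x)"
        using \<Omega> emeasure_bounded_finite[OF \<Omega>(2)] by (simp add: less_top)
      show "(\<lambda>x. - (indicator \<Omega> x * (G x \<bullet> i)) * \<phi> x) \<in> borel_measurable lebesgue"
        by (intro borel_measurable_times borel_measurable_uminus Gm measurable_completion) (simp add: \<phi>m)
      show "(\<lambda>x. (F (x + (- t n) *\<^sub>R i) - F x) / t n * \<phi> x) \<in> borel_measurable lebesgue" for n
        using Ftm Fm \<phi>m by (intro measurable_completion) auto
      show "AE x in lebesgue. (\<lambda>n. (F (x + (- t n) *\<^sub>R i) - F x) / t n * \<phi> x)
          \<longlonglongrightarrow> - (indicator \<Omega> x * (G x \<bullet> i)) * \<phi> x"
        using derivL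
      proof eventually_elim
        case (elim x)
        show ?case
        proof (cases "x \<in> K")
          case True
          with K elim have "(F has_derivative (\<lambda>h. G x \<bullet> h)) (at x)" using FD by blast
          from filterlim_compose[OF difference_quotient_tendsto[OF this] ta(2), of i]
          have "(\<lambda>n. (F (x + (- t n) *\<^sub>R i) - F x) / (- t n)) \<longlonglongrightarrow> G x \<bullet> i" .
          from tendsto_mult[OF tendsto_minus[OF this] tendsto_const[of "\<phi> x"]] True K(2)
          show ?thesis by (simp add: subset_iff)
        qed (simp add: out)
      qed
      show "AE x in lebesgue. norm ((F (x + (- t n) *\<^sub>R i) - F x) / t n * \<phi> x) \<le> \<bar>L\<bar> * C * indicator \<Omega> x" for n
      proof (intro AE_I2)
        fix x
        show "norm ((F (x + (- t n) *\<^sub>R i) - F x) / t n * \<phi> x) \<le> \<bar>L\<bar> * C * indicator \<Omega> x"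
        proof (cases "x \<in> K")
          case True
          have "\<bar>F (x + (- t n) *\<^sub>R i) - F x\<bar> \<le> L * dist (x + (- t n) *\<^sub>R i) x"
            by (rule eL[OF True]) (use t[of n] i in \<open>simp add: dist_norm\<close>)
          also have "\<dots> = L * t n" using t(1)[of n] i by (simp add: dist_norm)
          finally have "\<bar>F (x + (- t n) *\<^sub>R i) - F x\<bar> / t n \<le> L"
            using t(1)[of n] by (simp add: divide_le_eq)
          then have "\<bar>F (x + (- t n) *\<^sub>R i) - F x\<bar> / t n * \<bar>\<phi> x\<bar> \<le> \<bar>L\<bar> * C"
            using C(1)[of x] t(1)[of n] by (intro mult_mono) auto
          with True K(2) t(1)[of n] show ?thesis by (auto simp: abs_mult abs_divide)
        next
          case False
          have "C \<ge> 0" using C(1)[of x] by linarith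
          with False show ?thesis by (simp add: out)
        qed
      qed
    qed
    have eq2: "(\<integral>x. (F (x + (- t n) *\<^sub>R i) - F x) / t n * \<phi> x \<partial>lebesgue)
        = (\<integral>x. (F (x + (- t n) *\<^sub>R i) - F x) / t n * \<phi> x \<partial>lborel)" for n
      using Ftm Fm \<phi>m by (intro integral_completion) auto
    from lim1[unfolded eq1] lim2[unfolded eq2] have "(\<integral>x. F x * ?d x \<partial>lborel) = (\<integral>x. - (indicator \<Omega> x * (G x \<bullet> i)) * \<phi> x \<partial>lebesgue)"
      by (rule LIMSEQ_unique)
    moreover have "(\<integral>x. F x * ?d x \<partial>lborel) = (\<integral>x. f x * ?d x \<partial>?M)"
    proof -
      have "(\<integral>x. F x * ?d x \<partial>lborel) = (\<integral>x. F x * ?d x \<partial>lebesgue)"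
        using Fm dm by (intro integral_completion[symmetric]) auto
      also have "\<dots> = (\<integral>x. f x * ?d x \<partial>?M)"
        by (subst integral_restrict_space) (simp_all add: F_def mult.assoc)
      finally show ?thesis .
    qed
    moreover have "(\<integral>x. - (indicator \<Omega> x * (G x \<bullet> i)) * \<phi> x \<partial>lebesgue) = - (\<integral>x. (G x \<bullet> i) * \<phi> x \<partial>?M)"
      by (subst integral_restrict_space) (simp_all add: mult.assoc)
    ultimately show ?thesis by simp
  qed
  ultimately show ?thesis by (simp add: is_weak_grad_iff)
qed

subsection \<open>Lagrange spaces\<close>

text \<open>Bound and Lipschitz constant are carried through one induction because the Lipschitz
  estimate for a product uses bounds on both factors.\<close>

lemma real_polynomial_function_Lipschitz_bounded:
  fixes p :: "'a::euclidean_space \<Rightarrow> real"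
  assumes "real_polynomial_function p" and S: "bounded S"
  shows "\<exists>B L. L \<ge> 0 \<and> (\<forall>x\<in>S. \<bar>p x\<bar> \<le> B) \<and> (\<forall>x\<in>S. \<forall>y\<in>S. \<bar>p x - p y\<bar> \<le> L * dist x y)"
  using assms(1)
proof induction
  case (linear f)
  then obtain K where K: "K \<ge> 0" "\<And>x. norm (f x) \<le> norm x * K"
    using bounded_linear.nonneg_bounded by blast
  obtain R where R: "\<And>x. x \<in> S \<Longrightarrow> norm x \<le> R" using S bounded_iff by blast
  have "\<bar>f x\<bar> \<le> R * K" if "x \<in> S" for x
    using K(2)[of x] mult_right_mono[OF R[OF that] K(1)] by simp
  moreover have "\<bar>f x - f y\<bar> \<le> K * dist x y" for x y
    using K(2)[of "x - y"] linear by (simp add: linear_diff[OF bounded_linear.linear] dist_norm mult.commute)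
  ultimately show ?case using K(1) by (intro exI[of _ "R * K"] exI[of _ K]) simp
next
  case (const c)
  show ?case by (intro exI[of _ "\<bar>c\<bar>"] exI[of _ 0]) simp
next
  case (add f g)
  from add.IH(1) obtain B L where f: "L \<ge> 0" "\<forall>x\<in>S. \<bar>f x\<bar> \<le> B"
    "\<forall>x\<in>S. \<forall>y\<in>S. \<bar>f x - f y\<bar> \<le> L * dist x y" by (elim exE conjE)
  from add.IH(2) obtain B' L' where g: "L' \<ge> 0" "\<forall>x\<in>S. \<bar>g x\<bar> \<le> B'"
    "\<forall>x\<in>S. \<forall>y\<in>S. \<bar>g x - g y\<bar> \<le> L' * dist x y" by (elim exE conjE)
  note * = f(1) g(1) f(2)[rule_format] f(3)[rule_format] g(2)[rule_format] g(3)[rule_format]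
  have "\<bar>(f x + g x) - (f y + g y)\<bar> \<le> (L + L') * dist x y" if "x \<in> S" "y \<in> S" for x y
    using *(4,6)[OF that] by (simp add: distrib_right)
  moreover have "\<bar>f x + g x\<bar> \<le> B + B'" if "x \<in> S" for x
    using *(3,5)[OF that] by simp
  ultimately show ?case using *(1,2) by (intro exI[of _ "B + B'"] exI[of _ "L + L'"]) simp
next
  case (mult f g)
  from mult.IH(1) obtain B L where f: "L \<ge> 0" "\<forall>x\<in>S. \<bar>f x\<bar> \<le> B"
    "\<forall>x\<in>S. \<forall>y\<in>S. \<bar>f x - f y\<bar> \<le> L * dist x y" by (elim exE conjE)
  from mult.IH(2) obtain B' L' where g: "L' \<ge> 0" "\<forall>x\<in>S. \<bar>g x\<bar> \<le> B'"
    "\<forall>x\<in>S. \<forall>y\<in>S. \<bar>g x - g y\<bar> \<le> L' * dist x y" by (elim exE conjE)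
  note * = f(1) g(1) f(2)[rule_format] f(3)[rule_format] g(2)[rule_format] g(3)[rule_format]
  have "\<bar>f x * g x - f y * g y\<bar> \<le> (\<bar>B\<bar> * L' + \<bar>B'\<bar> * L) * dist x y" if "x \<in> S" "y \<in> S" for x y
  proof -
    have "f x * g x - f y * g y = f x * (g x - g y) + g y * (f x - f y)" by (simp add: algebra_simps)
    then have "\<bar>f x * g x - f y * g y\<bar> \<le> \<bar>f x\<bar> * \<bar>g x - g y\<bar> + \<bar>g y\<bar> * \<bar>f x - f y\<bar>"
      using abs_triangle_ineq[of "f x * (g x - g y)" "g y * (f x - f y)"] by (simp add: abs_mult)
    also have "\<dots> \<le> \<bar>B\<bar> * (L' * dist x y) + \<bar>B'\<bar> * (L * dist x y)"
      using *(4,6)[OF that] *(3)[OF that(1)] *(5)[OF that(2)] by (intro add_mono mult_mono) auto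
    finally show ?thesis by (simp add: distrib_right mult.assoc)
  qed
  moreover have "\<bar>f x * g x\<bar> \<le> \<bar>B\<bar> * \<bar>B'\<bar>" if "x \<in> S" for x
    unfolding abs_mult using *(3,5)[OF that] by (intro mult_mono) auto
  ultimately show ?case using *(1,2)
    by (intro exI[of _ "\<bar>B\<bar> * \<bar>B'\<bar>"] exI[of _ "\<bar>B\<bar> * L' + \<bar>B'\<bar> * L"]) simp
qed

lemma finite_multi_indices: "finite (multi_indices k :: ('a::euclidean_space \<Rightarrow> nat) set)"
proof (rule finite_subset)
  show "multi_indices k \<subseteq> {\<alpha>. \<forall>i::'a. (i \<in> Basis \<longrightarrow> \<alpha> i \<in> {..k}) \<and> (i \<notin> Basis \<longrightarrow> \<alpha> i = 0)}"
  proof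
    fix \<alpha> :: "'a \<Rightarrow> nat" assume a: "\<alpha> \<in> multi_indices k"
    then have "\<alpha> i \<le> k" if "i \<in> Basis" for i
      using member_le_sum[OF that, of \<alpha>] by (auto simp: multi_indices_def)
    with a show "\<alpha> \<in> {\<alpha>. \<forall>i::'a. (i \<in> Basis \<longrightarrow> \<alpha> i \<in> {..k}) \<and> (i \<notin> Basis \<longrightarrow> \<alpha> i = 0)}"
      by (auto simp: multi_indices_def)
  qed
qed (rule finite_set_of_finite_funs; simp)

text \<open>Gives access to the induction principle and the differentiability of polynomial
  functions.\<close>

lemma poly_on_real_polynomial_function:
  fixes f :: "'a::euclidean_space \<Rightarrow> real"
  assumes "poly_on K k f"
  obtains p where "real_polynomial_function p" "\<And>x. x \<in> K \<Longrightarrow> f x = p x"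
proof -
  obtain c where c: "\<And>x. x \<in> K \<Longrightarrow> f x = (\<Sum>\<alpha>\<in>multi_indices k. c \<alpha> * (\<Prod>i\<in>Basis. (x \<bullet> i) ^ \<alpha> i))"
    using assms unfolding poly_on_def by blast
  have "real_polynomial_function (\<lambda>x::'a. (x \<bullet> i) ^ n)" for i n
  proof (induction n)
    case 0
    then show ?case by (simp add: real_polynomial_function.intros(2))
  next
    case (Suc n)
    from real_polynomial_function.intros(4)[OF real_polynomial_function.intros(1)[OF bounded_linear_inner_left] Suc]
    show ?case by simp
  qed
  then have "real_polynomial_function (\<lambda>x::'a. \<Sum>\<alpha>\<in>multi_indices k. c \<alpha> * (\<Prod>i\<in>Basis. (x \<bullet> i) ^ \<alpha> i))"
    by (intro real_polynomial_function_sum real_polynomial_function.intros(4) real_polynomial_function.intros(2)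
        real_polynomial_function_prod finite_multi_indices) auto
  with c show thesis using that by blast
qed

lemma poly_on_cong: "poly_on K k f \<Longrightarrow> (\<And>x. x \<in> K \<Longrightarrow> g x = f x) \<Longrightarrow> poly_on K k g"
  unfolding poly_on_def by (simp cong: ball_cong)

text \<open>The added constant only changes the coefficient of the zero multi-index, which is
  present for every degree bound k.\<close>

lemma poly_on_affine:
  fixes f :: "'a::euclidean_space \<Rightarrow> real"
  assumes "poly_on K k f"
  shows "poly_on K k (\<lambda>x. a * f x + b)"
proof -
  obtain c where c: "\<And>x. x \<in> K \<Longrightarrow> f x = (\<Sum>\<alpha>\<in>multi_indices k. c \<alpha> * (\<Prod>i\<in>Basis. (x \<bullet> i) ^ \<alpha> i))"
    using assms unfolding poly_on_def by blast
  have z: "(\<lambda>_::'a. 0::nat) \<in> multi_indices k" by (simp add: multi_indices_def)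
  have "(\<Sum>\<alpha>\<in>multi_indices k. (a * c \<alpha> + (if \<alpha> = (\<lambda>_. 0) then b else 0)) * (\<Prod>i\<in>Basis. (x \<bullet> i) ^ \<alpha> i)) = a * f x + b"
    if "x \<in> K" for x
  proof -
    have "(\<Sum>\<alpha>\<in>multi_indices k. (if \<alpha> = (\<lambda>_. 0) then b else 0) * (\<Prod>i\<in>Basis. (x \<bullet> i) ^ \<alpha> i))
        = (\<Sum>\<alpha>\<in>(multi_indices k :: ('a \<Rightarrow> nat) set). if \<alpha> = (\<lambda>_. 0) then b else 0)"
      by (intro sum.cong refl) simp
    also have "\<dots> = b" using z by (simp add: sum.delta[OF finite_multi_indices])
    finally show ?thesis
      using c[OF that] by (simp add: distrib_right sum.distrib sum_distrib_left mult.assoc)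
  qed
  then show ?thesis unfolding poly_on_def
    by (intro exI[of _ "\<lambda>\<alpha>. a * c \<alpha> + (if \<alpha> = (\<lambda>_. 0) then b else 0)"]) simp
qed

text \<open>Serves to correct mean and norm inside the discrete space. The constant is multiplied by
  the indicator of the closure because members must vanish outside it; the covering hypothesis makes
  that indicator 1 on each element.\<close>

lemma lagrange_space_affine:
  assumes v: "v \<in> lagrange_space \<T> k \<Omega>" and cover: "\<Union>\<T> = closure \<Omega>"
  shows "(\<lambda>x. a * v x + b * indicator (closure \<Omega>) x) \<in> lagrange_space \<T> k \<Omega>"
proof -
  have eq: "a * v x + b * indicator (closure \<Omega>) x = a * v x + b" if "x \<in> closure \<Omega>" for x
    using that by simp
  have "continuous_on (closure \<Omega>) (\<lambda>x. a * v x + b)"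
    using v by (auto simp: lagrange_space_def intro!: continuous_intros)
  then have "continuous_on (closure \<Omega>) (\<lambda>x. a * v x + b * indicator (closure \<Omega>) x)"
    using eq by (simp cong: continuous_on_cong_simp)
  moreover have "poly_on K k (\<lambda>x. a * v x + b * indicator (closure \<Omega>) x)" if K: "K \<in> \<T>" for K
  proof -
    have "poly_on K k (\<lambda>x. a * v x + b)"
      using v K by (intro poly_on_affine) (auto simp: lagrange_space_def)
    moreover have "a * v x + b * indicator (closure \<Omega>) x = a * v x + b" if "x \<in> K" for x
      by (rule eq) (use that K cover in blast)
    ultimately show ?thesis by (rule poly_on_cong)
  qed
  ultimately show ?thesis using v by (simp add: lagrange_space_def)
qed

text \<open>Parametrize the segment by the unit interval. The preimages of the pieces are finitely
  many closed sets covering the interval, and a function that is Lipschitz with one constant on each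
  of them is so on the whole interval.\<close>

lemma Lipschitz_on_segment_of_piecewise:
  fixes v :: "'a::euclidean_space \<Rightarrow> real"
  assumes fin: "finite \<T>" and cl: "\<And>K. K \<in> \<T> \<Longrightarrow> closed K"
    and L: "L \<ge> 0" "\<And>K y z. K \<in> \<T> \<Longrightarrow> y \<in> K \<Longrightarrow> z \<in> K \<Longrightarrow> \<bar>v y - v z\<bar> \<le> L * dist y z"
    and seg: "closed_segment x y \<subseteq> \<Union>\<T>"
  shows "\<bar>v x - v y\<bar> \<le> L * dist x y"
proof -
  define p where "p t = x + t *\<^sub>R (y - x)" for t :: real
  define U where "U K = {0..1} \<inter> p -` K" for K
  have pd: "dist (p s) (p t) = \<bar>s - t\<bar> * dist x y" for s t
  proof -
    have "p s - p t = (s - t) *\<^sub>R (y - x)" by (simp add: p_def scaleR_diff_left)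
    then show ?thesis by (simp add: dist_norm norm_minus_commute[of x y])
  qed
  have "(L * dist x y)-lipschitz_on {0..1} (v \<circ> p)"
  proof (rule lipschitz_on_closed_Union[OF _ _ fin])
    show "(L * dist x y)-lipschitz_on (U K) (v \<circ> p)" if K: "K \<in> \<T>" for K
    proof (rule lipschitz_onI)
      fix s t assume "s \<in> U K" "t \<in> U K"
      then have "\<bar>v (p s) - v (p t)\<bar> \<le> L * dist (p s) (p t)" using L(2)[OF K] by (simp add: U_def)
      then show "dist ((v \<circ> p) s) ((v \<circ> p) t) \<le> L * dist x y * dist s t"
        by (simp add: pd dist_real_def mult_ac)
    qed (use L(1) in simp)
    have "continuous_on {0..1} p" unfolding p_def by (intro continuous_intros)
    then show "closed (U K)" if "K \<in> \<T>" for K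
      unfolding U_def using cl[OF that] by (intro continuous_closed_preimage) auto
    have "p t \<in> closed_segment x y" if "t \<in> {0..1}" for t
      using that by (auto simp: p_def in_segment algebra_simps intro!: exI[of _ t])
    then show "{0..1} \<subseteq> (\<Union>K\<in>\<T>. U K)" using seg by (fastforce simp: U_def)
  qed (use L(1) in simp)
  then have "dist ((v \<circ> p) 0) ((v \<circ> p) 1) \<le> L * dist x y * dist (0::real) 1"
    by (rule lipschitz_onD) auto
  then show ?thesis by (simp add: p_def dist_real_def)
qed

lemma has_derivative_gradient:
  fixes f :: "'a::euclidean_space \<Rightarrow> real"
  assumes "(f has_derivative D) (at x)"
  shows "(f has_derivative (\<lambda>h. (\<Sum>i\<in>Basis. D i *\<^sub>R i) \<bullet> h)) (at x)"
proof -
  interpret D: linear D by (rule has_derivative_linear[OF assms])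
  have "D h = (\<Sum>i\<in>Basis. D i *\<^sub>R i) \<bullet> h" for h
  proof -
    have "D h = D (\<Sum>i\<in>Basis. (h \<bullet> i) *\<^sub>R i)" by (simp add: euclidean_representation)
    then show ?thesis by (simp add: D.sum D.scale inner_sum_left inner_commute[of h] mult.commute)
  qed
  then have "D = (\<lambda>h. (\<Sum>i\<in>Basis. D i *\<^sub>R i) \<bullet> h)" by (rule ext)
  with assms show ?thesis by simp
qed

text \<open>On each element v is a polynomial, which gives Lipschitz bounds there; segments inside a
  small ball carry them across element boundaries. In the interior of an element v is
  differentiable, and what remains lies in finitely many frontiers.\<close>

lemma lagrange_space_regularity:
  fixes \<Omega> :: "'a::euclidean_space set"
  assumes \<Omega>: "open \<Omega>" "bounded \<Omega>" and tri: "triangulation \<Omega> \<T>" and v: "v \<in> lagrange_space \<T> k \<Omega>"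
  obtains B L G where "\<And>x. x \<in> \<Omega> \<Longrightarrow> \<bar>v x\<bar> \<le> B" "L \<ge> 0"
    "\<And>x. x \<in> \<Omega> \<Longrightarrow> \<exists>r>0. ball x r \<subseteq> \<Omega> \<and> (\<forall>y\<in>ball x r. \<forall>z\<in>ball x r. \<bar>v y - v z\<bar> \<le> L * dist y z)"
    "AE x in lebesgue_on \<Omega>. (v has_derivative (\<lambda>h. G x \<bullet> h)) (at x)"
proof -
  have T: "finite \<T>" "\<Union>\<T> = closure \<Omega>" "\<And>K. K \<in> \<T> \<Longrightarrow> int DIM('a) simplex K"
    using tri by (auto simp: triangulation_def)
  have Kc: "compact K" "convex K" if "K \<in> \<T>" for K
    using T(3)[OF that] compact_simplex convex_simplex by blast+
  have "compact (v ` closure \<Omega>)"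
    using v \<Omega>(2) by (intro compact_continuous_image) (auto simp: lagrange_space_def compact_closure)
  from compact_imp_bounded[OF this] obtain B where B: "\<And>x. x \<in> closure \<Omega> \<Longrightarrow> \<bar>v x\<bar> \<le> B"
    unfolding bounded_iff by auto
  have "\<exists>p. real_polynomial_function p \<and> (\<forall>x\<in>K. v x = p x)" if "K \<in> \<T>" for K
  proof -
    have "poly_on K k v" using v that by (simp add: lagrange_space_def)
    from poly_on_real_polynomial_function[OF this] show ?thesis by metis
  qed
  then obtain p where p: "\<And>K. K \<in> \<T> \<Longrightarrow> real_polynomial_function (p K)"
    "\<And>K x. K \<in> \<T> \<Longrightarrow> x \<in> K \<Longrightarrow> v x = p K x" by metis
  have "\<exists>L\<ge>0. \<forall>y\<in>K. \<forall>z\<in>K. \<bar>p K y - p K z\<bar> \<le> L * dist y z" if "K \<in> \<T>" for K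
    using real_polynomial_function_Lipschitz_bounded[OF p(1)[OF that] compact_imp_bounded[OF Kc(1)[OF that]]] by blast
  then obtain l where l: "\<And>K. K \<in> \<T> \<Longrightarrow> l K \<ge> 0"
    "\<And>K y z. K \<in> \<T> \<Longrightarrow> y \<in> K \<Longrightarrow> z \<in> K \<Longrightarrow> \<bar>p K y - p K z\<bar> \<le> l K * dist y z" by metis
  \<comment> \<open>The sum is a convenient common upper bound for the finitely many element
    constants.\<close>
  define L where "L = sum l \<T>"
  have L0: "L \<ge> 0" unfolding L_def using l(1) by (rule sum_nonneg)
  have lK: "\<bar>v y - v z\<bar> \<le> L * dist y z" if "K \<in> \<T>" "y \<in> K" "z \<in> K" for K y z
  proof -
    have "l K \<le> L" unfolding L_def by (rule member_le_sum) (use that l(1) T(1) in auto)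
    then have "l K * dist y z \<le> L * dist y z" by (intro mult_right_mono) auto
    with l(2)[OF that] p(2) that show ?thesis by simp
  qed
  have lip: "\<exists>r>0. ball x r \<subseteq> \<Omega> \<and> (\<forall>y\<in>ball x r. \<forall>z\<in>ball x r. \<bar>v y - v z\<bar> \<le> L * dist y z)"
    if x: "x \<in> \<Omega>" for x
  proof -
    obtain r where r: "r > 0" "ball x r \<subseteq> \<Omega>" using \<Omega>(1) x open_contains_ball by blast
    have "\<bar>v y - v z\<bar> \<le> L * dist y z" if yz: "y \<in> ball x r" "z \<in> ball x r" for y z
    proof (rule Lipschitz_on_segment_of_piecewise[OF T(1) _ L0 lK])
      have "closed_segment y z \<subseteq> ball x r"
        by (rule closed_segment_subset[OF yz convex_ball])
      then show "closed_segment y z \<subseteq> \<Union>\<T>"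
        using r(2) closure_subset[of \<Omega>] T(2) by simp
    qed (use Kc(1) compact_imp_closed in auto)
    with r show ?thesis by blast
  qed
  define G where "G x = (\<Sum>i\<in>Basis. frechet_derivative v (at x) i *\<^sub>R i)" for x
  \<comment> \<open>Frontiers of convex sets are null sets; a point of an element that avoids its
    frontier is an interior point.\<close>
  have "negligible (\<Union>K\<in>\<T>. frontier K)"
    using T(1) Kc(2) by (intro negligible_Union) (auto simp: negligible_convex_frontier)
  then have "AE x in lebesgue. x \<notin> (\<Union>K\<in>\<T>. frontier K)"
    unfolding negligible_iff_null_sets by (rule AE_not_in)
  then have "AE x in lebesgue. x \<in> \<Omega> \<longrightarrow> (v has_derivative (\<lambda>h. G x \<bullet> h)) (at x)"
  proof eventually_elim
    case (elim x)
    show ?case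
    proof
      assume "x \<in> \<Omega>"
      then have "x \<in> \<Union>\<T>" using T(2) closure_subset[of \<Omega>] by auto
      then obtain K where K: "K \<in> \<T>" "x \<in> K" by blast
      then have xi: "x \<in> interior K" using elim closure_subset[of K] by (auto simp: frontier_def)
      obtain D where "(p K has_derivative D) (at x)"
        using differentiable_at_real_polynomial_function[OF p(1)[OF K(1)]] unfolding differentiable_def by blast
      then have "(v has_derivative D) (at x)"
        by (rule has_derivative_transform_within_open[OF _ open_interior xi])
           (use p(2)[OF K(1)] interior_subset in force)
      then have "(v has_derivative frechet_derivative v (at x)) (at x)"
        using frechet_derivative_at by force
      then show "(v has_derivative (\<lambda>h. G x \<bullet> h)) (at x)"
        unfolding G_def by (rule has_derivative_gradient)
    qed
  qed
  then have "AE x in lebesgue_on \<Omega>. (v has_derivative (\<lambda>h. G x \<bullet> h)) (at x)"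
    using open_in_sets_lebesgue[OF \<Omega>(1)] by (simp add: AE_restrict_space_iff)
  moreover have "\<bar>v x\<bar> \<le> B" if "x \<in> \<Omega>" for x
    using B that closure_subset by blast
  ultimately show thesis using that[of B L G] L0 lip by blast
qed

subsection \<open>Volume-preserving changes of variables\<close>

text \<open>Continuity of the partial derivatives on a compact set gives one bound for all
  derivatives there. Applied to the closure of \<Omega>1, it yields an estimate that does not
  degenerate towards the boundary.\<close>

lemma smooth_map_derivative:
  fixes F :: "'a::euclidean_space \<Rightarrow> 'a"
  assumes U: "open U" and F: "smooth_map_on U F" and K: "compact K" "K \<subseteq> U"
  obtains D C where "\<And>y. y \<in> U \<Longrightarrow> (F has_derivative D y) (at y)"
    "\<And>i. i \<in> Basis \<Longrightarrow> continuous_on U (\<lambda>y. D y i)"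
    "C \<ge> 0" "\<And>y h. y \<in> K \<Longrightarrow> norm (D y h) \<le> C * norm h"
proof -
  define d where "d j y = frechet_derivative (\<lambda>x. F x \<bullet> j) (at y)" for j y
  define D where "D y h = (\<Sum>j\<in>Basis. d j y h *\<^sub>R j)" for y h
  have Ck: "Ck_on (Suc 0) U (\<lambda>x. F x \<bullet> j)" if "j \<in> Basis" for j
    using F that unfolding smooth_map_on_def smooth_on_def by blast
  have d: "((\<lambda>x. F x \<bullet> j) has_derivative d j y) (at y)" if j: "j \<in> Basis" and y: "y \<in> U" for j y
  proof -
    have "(\<lambda>x. F x \<bullet> j) differentiable (at y within U)"
      using Ck[OF j] y by (simp add: differentiable_on_def)
    then have "(\<lambda>x. F x \<bullet> j) differentiable (at y)"
      by (simp only: at_within_open[OF y U])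
    then show ?thesis unfolding d_def frechet_derivative_works .
  qed
  have dc: "continuous_on U (\<lambda>y. d j y i)" if "j \<in> Basis" "i \<in> Basis" for j i
    using Ck[OF that(1)] that(2) unfolding d_def by simp
  have D: "(F has_derivative D y) (at y)" if "y \<in> U" for y
    unfolding has_derivative_componentwise_within[of F]
  proof
    fix j :: 'a assume j: "j \<in> Basis"
    have "(\<lambda>h. D y h \<bullet> j) = d j y"
      using j by (simp add: D_def inner_sum_left inner_Basis if_distrib cong: if_cong)
    then show "((\<lambda>x. F x \<bullet> j) has_derivative (\<lambda>h. D y h \<bullet> j)) (at y)"
      using d[OF j that] by simp
  qed
  have Dc: "continuous_on U (\<lambda>y. D y i)" if "i \<in> Basis" for i
    unfolding D_def using that by (intro continuous_intros dc)
  have "\<exists>B. \<forall>y\<in>K. norm (D y i) \<le> B" if "i \<in> Basis" for i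
  proof -
    have "compact ((\<lambda>y. D y i) ` K)"
      by (rule compact_continuous_image[OF continuous_on_subset[OF Dc[OF that] K(2)] K(1)])
    from compact_imp_bounded[OF this] show ?thesis unfolding bounded_iff by auto
  qed
  then obtain b where b: "\<And>i y. i \<in> Basis \<Longrightarrow> y \<in> K \<Longrightarrow> norm (D y i) \<le> b i" by metis
  have "norm (D y h) \<le> (\<Sum>i\<in>Basis. \<bar>b i\<bar>) * norm h" if y: "y \<in> K" for y h
  proof -
    interpret D: linear "D y" by (rule has_derivative_linear[OF D]) (use y K in blast)
    have "D y h = D y (\<Sum>i\<in>Basis. (h \<bullet> i) *\<^sub>R i)" by (simp add: euclidean_representation)
    also have "\<dots> = (\<Sum>i\<in>Basis. (h \<bullet> i) *\<^sub>R D y i)" by (simp only: D.sum D.scale)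
    finally have "norm (D y h) \<le> (\<Sum>i\<in>Basis. norm ((h \<bullet> i) *\<^sub>R D y i))"
      using norm_sum[of "\<lambda>i. (h \<bullet> i) *\<^sub>R D y i" Basis] by simp
    also have "\<dots> \<le> (\<Sum>i\<in>Basis. norm h * \<bar>b i\<bar>)"
    proof (rule sum_mono)
      fix i :: 'a assume i: "i \<in> Basis"
      have "\<bar>h \<bullet> i\<bar> * norm (D y i) \<le> norm h * \<bar>b i\<bar>"
        using Basis_le_norm[OF i, of h] b[OF i y] by (intro mult_mono) auto
      then show "norm ((h \<bullet> i) *\<^sub>R D y i) \<le> norm h * \<bar>b i\<bar>" by simp
    qed
    finally show ?thesis by (simp add: sum_distrib_left mult.commute)
  qed
  then show thesis using that[of D "\<Sum>i\<in>Basis. \<bar>b i\<bar>"] D Dc by (simp add: sum_nonneg)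
qed

text \<open>S stands for the inverse of T, D for the derivative of S. The derivative data are
  required on \<Omega>1 only, so the smooth extension beyond the closure enters solely through the
  instantiation. Volume preservation is kept as a statement about measures of images, so no Jacobian
  determinant occurs.\<close>

locale volume_preserving_map =
  fixes \<Omega>0 \<Omega>1 :: "'a::euclidean_space set" and T S :: "'a \<Rightarrow> 'a" and D :: "'a \<Rightarrow> 'a \<Rightarrow> 'a" and C :: real
  assumes \<Omega>0: "open \<Omega>0" "bounded \<Omega>0" and \<Omega>1: "open \<Omega>1" "bounded \<Omega>1"
    and T_img: "T ` \<Omega>0 = \<Omega>1" and S_img: "S ` \<Omega>1 = \<Omega>0"
    and ST: "\<And>x. x \<in> \<Omega>0 \<Longrightarrow> S (T x) = x" and TS: "\<And>y. y \<in> \<Omega>1 \<Longrightarrow> T (S y) = y"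
    and vol: "\<And>A. A \<in> sets lebesgue \<Longrightarrow> A \<subseteq> \<Omega>0 \<Longrightarrow>
      T ` A \<in> sets lebesgue \<and> emeasure lebesgue (T ` A) = emeasure lebesgue A"
    and deriv: "\<And>y. y \<in> \<Omega>1 \<Longrightarrow> (S has_derivative D y) (at y)"
    and deriv_cont: "\<And>i. i \<in> Basis \<Longrightarrow> continuous_on \<Omega>1 (\<lambda>y. D y i)"
    and C_nonneg: "C \<ge> 0" and deriv_bound: "\<And>y h. y \<in> \<Omega>1 \<Longrightarrow> norm (D y h) \<le> C * norm h"
begin

lemmas \<Omega>_sets = open_in_sets_lebesgue[OF \<Omega>0(1)] open_in_sets_lebesgue[OF \<Omega>1(1)]

lemma vimage_eq: "A \<subseteq> \<Omega>0 \<Longrightarrow> S -` A \<inter> \<Omega>1 = T ` A"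
  using ST TS T_img S_img by force

text \<open>A preimage under S is an image under T, so measurability of S is exactly the
  measurability half of \<open>vol\<close>.\<close>

lemma S_measurable: "S \<in> measurable (lebesgue_on \<Omega>1) (lebesgue_on \<Omega>0)"
proof (rule measurableI)
  show "S x \<in> space (lebesgue_on \<Omega>0)" if "x \<in> space (lebesgue_on \<Omega>1)" for x
    using that S_img by auto
  fix A assume "A \<in> sets (lebesgue_on \<Omega>0)"
  then have A: "A \<subseteq> \<Omega>0" "A \<in> sets lebesgue" using \<Omega>_sets by (auto simp: sets_restrict_space_iff)
  then show "S -` A \<inter> space (lebesgue_on \<Omega>1) \<in> sets (lebesgue_on \<Omega>1)"
    using vol[OF A(2,1)] T_img \<Omega>_sets by (auto simp: sets_restrict_space_iff vimage_eq)
qed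

text \<open>The change of variables in measure form; integrals, integrability and null sets are all
  transported through it.\<close>

lemma distr_S: "distr (lebesgue_on \<Omega>1) (lebesgue_on \<Omega>0) S = lebesgue_on \<Omega>0"
proof (rule measure_eqI)
  fix A assume "A \<in> sets (distr (lebesgue_on \<Omega>1) (lebesgue_on \<Omega>0) S)"
  then have A': "A \<in> sets (lebesgue_on \<Omega>0)" by simp
  then have A: "A \<subseteq> \<Omega>0" "A \<in> sets lebesgue" using \<Omega>_sets by (auto simp: sets_restrict_space_iff)
  have "emeasure (distr (lebesgue_on \<Omega>1) (lebesgue_on \<Omega>0) S) A = emeasure (lebesgue_on \<Omega>1) (T ` A)"
    using emeasure_distr[OF S_measurable A'] vimage_eq[OF A(1)] by simp
  also have "\<dots> = emeasure lebesgue (T ` A)"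
    using A(1) T_img \<Omega>_sets by (intro emeasure_restrict_space) auto
  also have "\<dots> = emeasure lebesgue A" using vol[OF A(2,1)] by blast
  also have "\<dots> = emeasure (lebesgue_on \<Omega>0) A"
    using A(1) \<Omega>_sets by (intro emeasure_restrict_space[symmetric]) auto
  finally show "emeasure (distr (lebesgue_on \<Omega>1) (lebesgue_on \<Omega>0) S) A = emeasure (lebesgue_on \<Omega>0) A" .
qed simp

lemma sq_integrable_compose:
  assumes f: "sq_integrable (lebesgue_on \<Omega>0) f"
  shows "sq_integrable (lebesgue_on \<Omega>1) (\<lambda>y. f (S y))"
    and "norm2 (lebesgue_on \<Omega>1) (\<lambda>y. f (S y)) = norm2 (lebesgue_on \<Omega>0) f"
proof -
  have fm: "f \<in> borel_measurable (lebesgue_on \<Omega>0)" and fi: "integrable (lebesgue_on \<Omega>0) (\<lambda>x. (norm (f x))\<^sup>2)"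
    using f by (auto simp: sq_integrable_def)
  have fm2: "(\<lambda>x. (norm (f x))\<^sup>2) \<in> borel_measurable (lebesgue_on \<Omega>0)" using fi by simp
  show "sq_integrable (lebesgue_on \<Omega>1) (\<lambda>y. f (S y))"
    unfolding sq_integrable_def
  proof
    show "(\<lambda>y. f (S y)) \<in> borel_measurable (lebesgue_on \<Omega>1)"
      by (rule measurable_compose[OF S_measurable fm])
    show "integrable (lebesgue_on \<Omega>1) (\<lambda>y. (norm (f (S y)))\<^sup>2)"
      using fi integrable_distr_eq[OF S_measurable fm2] by (simp add: distr_S)
  qed
  show "norm2 (lebesgue_on \<Omega>1) (\<lambda>y. f (S y)) = norm2 (lebesgue_on \<Omega>0) f"
    using integral_distr[OF S_measurable fm2] by (simp add: norm2_def distr_S)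
qed

lemma AE_compose: "AE x in lebesgue_on \<Omega>0. P x \<Longrightarrow> AE y in lebesgue_on \<Omega>1. P (S y)"
  by (rule AE_distrD[OF S_measurable]) (simp only: distr_S)

text \<open>The transformed gradient \<open>(D S)\<^sup>T (G \<circ> S)\<close>.\<close>

definition pull_grad :: "('a \<Rightarrow> 'a) \<Rightarrow> 'a \<Rightarrow> 'a" where
  "pull_grad G y = (\<Sum>i\<in>Basis. (G (S y) \<bullet> D y i) *\<^sub>R i)"

lemma pull_grad_diff: "pull_grad (\<lambda>x. G x - H x) y = pull_grad G y - pull_grad H y"
  by (simp add: pull_grad_def inner_diff_left scaleR_diff_left sum_subtractf)

text \<open>The adjoint identity that makes \<open>pull_grad\<close> the gradient given by the chain
  rule.\<close>

lemma inner_pull_grad: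
  assumes "y \<in> \<Omega>1"
  shows "pull_grad G y \<bullet> h = G (S y) \<bullet> D y h"
proof -
  interpret D: linear "D y" by (rule has_derivative_linear[OF deriv[OF assms]])
  have "D y h = D y (\<Sum>i\<in>Basis. (h \<bullet> i) *\<^sub>R i)" by (simp add: euclidean_representation)
  also have "\<dots> = (\<Sum>i\<in>Basis. (h \<bullet> i) *\<^sub>R D y i)" by (simp only: D.sum D.scale)
  finally show ?thesis
    by (simp add: pull_grad_def inner_sum_left inner_sum_right inner_commute[of h] mult.commute)
qed

text \<open>The dimension factor comes from adding the bounds of the components; only its
  independence of y matters.\<close>

lemma norm_pull_grad:
  assumes y: "y \<in> \<Omega>1"
  shows "norm (pull_grad G y) \<le> real DIM('a) * C * norm (G (S y))"
proof -
  have "norm (pull_grad G y) \<le> (\<Sum>i\<in>(Basis::'a set). C * norm (G (S y)))"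
    unfolding pull_grad_def
  proof (rule sum_norm_le)
    fix i :: 'a assume i: "i \<in> Basis"
    have "\<bar>G (S y) \<bullet> D y i\<bar> \<le> norm (G (S y)) * norm (D y i)" by (rule Cauchy_Schwarz_ineq2)
    also have "\<dots> \<le> norm (G (S y)) * C"
      using deriv_bound[OF y, of i] i by (intro mult_left_mono) auto
    finally show "norm ((G (S y) \<bullet> D y i) *\<^sub>R i) \<le> C * norm (G (S y))"
      using i by (simp add: mult.commute)
  qed
  then show ?thesis by (simp add: mult.assoc)
qed

lemma sq_integrable_pull_grad:
  assumes G: "sq_integrable (lebesgue_on \<Omega>0) G"
  shows "sq_integrable (lebesgue_on \<Omega>1) (pull_grad G)"
    and "norm2 (lebesgue_on \<Omega>1) (pull_grad G) \<le> real DIM('a) * C * norm2 (lebesgue_on \<Omega>0) G"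
proof -
  let ?M = "lebesgue_on \<Omega>1"
  let ?c = "real DIM('a) * C"
  note GS = sq_integrable_compose[OF G]
  have c0: "?c \<ge> 0" using C_nonneg by simp
  have m: "pull_grad G \<in> borel_measurable ?M"
    unfolding pull_grad_def
  proof (intro borel_measurable_sum borel_measurable_scaleR borel_measurable_inner borel_measurable_const)
    show "(\<lambda>y. G (S y)) \<in> borel_measurable ?M" by (rule sq_integrable_measurable[OF GS(1)])
    show "(\<lambda>y. D y i) \<in> borel_measurable ?M" if "i \<in> Basis" for i
      by (rule continuous_imp_measurable_on_sets_lebesgue[OF deriv_cont[OF that] \<Omega>_sets(2)])
  qed
  have i: "integrable ?M (\<lambda>y. ?c\<^sup>2 * (norm (G (S y)))\<^sup>2)" using GS(1) by (simp add: sq_integrable_def)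
  have le: "(norm (pull_grad G y))\<^sup>2 \<le> ?c\<^sup>2 * (norm (G (S y)))\<^sup>2" if "y \<in> \<Omega>1" for y
    unfolding power_mult_distrib[symmetric] by (rule power_mono[OF norm_pull_grad[OF that]]) simp
  have pi: "integrable ?M (\<lambda>y. (norm (pull_grad G y))\<^sup>2)"
    using m le by (intro Bochner_Integration.integrable_bound[OF i]) (auto intro!: AE_I2)
  with m show sq: "sq_integrable ?M (pull_grad G)" by (simp add: sq_integrable_def)
  have "(norm2 ?M (pull_grad G))\<^sup>2 \<le> (\<integral>y. ?c\<^sup>2 * (norm (G (S y)))\<^sup>2 \<partial>?M)"
    unfolding norm2_power2 by (rule integral_mono[OF pi i]) (use le in simp)
  also have "\<dots> = (?c * norm2 (lebesgue_on \<Omega>0) G)\<^sup>2"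
    using GS(2) norm2_power2[of ?M "\<lambda>y. G (S y)"] by (simp add: power_mult_distrib)
  finally show "norm2 ?M (pull_grad G) \<le> ?c * norm2 (lebesgue_on \<Omega>0) G"
    by (rule power2_le_imp_le) (rule mult_nonneg_nonneg[OF c0 norm2_nonneg])
qed

section \<open>Push-forwards of functions and of weak gradients\<close>

lemma push_eq: "y \<in> \<Omega>1 \<Longrightarrow> push \<Omega>1 S u y = u (S y)"
  by (simp add: push_def)

lemma sq_integrable_push:
  assumes u: "sq_integrable (lebesgue_on \<Omega>0) u"
  shows "sq_integrable (lebesgue_on \<Omega>1) (push \<Omega>1 S u)"
    and "norm2 (lebesgue_on \<Omega>1) (push \<Omega>1 S u) = norm2 (lebesgue_on \<Omega>0) u"
proof -
  have "sq_integrable (lebesgue_on \<Omega>1) (push \<Omega>1 S u) = sq_integrable (lebesgue_on \<Omega>1) (\<lambda>y. u (S y))"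
    unfolding sq_integrable_def
    by (intro conj_cong measurable_cong Bochner_Integration.integrable_cong) (auto simp: push_eq)
  moreover have "norm2 (lebesgue_on \<Omega>1) (push \<Omega>1 S u) = norm2 (lebesgue_on \<Omega>1) (\<lambda>y. u (S y))"
    unfolding norm2_def
    by (intro arg_cong[where f=sqrt] Bochner_Integration.integral_cong) (auto simp: push_eq)
  ultimately show "sq_integrable (lebesgue_on \<Omega>1) (push \<Omega>1 S u)"
    "norm2 (lebesgue_on \<Omega>1) (push \<Omega>1 S u) = norm2 (lebesgue_on \<Omega>0) u"
    using sq_integrable_compose[OF u] by simp_all
qed

text \<open>The composite is locally Lipschitz with constant L times C, and the chain rule holds
  almost everywhere because S pulls null sets back to null sets.\<close>

lemma weak_grad_push_of_locally_Lipschitz: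
  fixes f :: "'a \<Rightarrow> real"
  assumes B: "\<And>x. x \<in> \<Omega>0 \<Longrightarrow> \<bar>f x\<bar> \<le> B" and L: "L \<ge> 0"
    and lip: "\<And>x. x \<in> \<Omega>0 \<Longrightarrow> \<exists>r>0. ball x r \<subseteq> \<Omega>0 \<and> (\<forall>y\<in>ball x r. \<forall>z\<in>ball x r. \<bar>f y - f z\<bar> \<le> L * dist y z)"
    and fG: "AE x in lebesgue_on \<Omega>0. (f has_derivative (\<lambda>h. G x \<bullet> h)) (at x)"
  shows "is_weak_grad \<Omega>1 (push \<Omega>1 S f) (pull_grad G)"
proof (rule weak_grad_of_locally_Lipschitz[OF \<Omega>1])
  show "\<bar>push \<Omega>1 S f y\<bar> \<le> B" if "y \<in> \<Omega>1" for y
    using that B S_img by (auto simp: push_eq)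
  fix y assume y: "y \<in> \<Omega>1"
  then have "S y \<in> \<Omega>0" using S_img by blast
  from lip[OF this] obtain r where r: "r > 0"
    "\<And>a b. a \<in> ball (S y) r \<Longrightarrow> b \<in> ball (S y) r \<Longrightarrow> \<bar>f a - f b\<bar> \<le> L * dist a b" by blast
  have "isCont S y" by (rule has_derivative_continuous[OF deriv[OF y]])
  then obtain s where s: "s > 0" "\<And>z. dist z y < s \<Longrightarrow> dist (S z) (S y) < r"
    unfolding continuous_at_eps_delta using r(1) by blast
  obtain q where q: "q > 0" "ball y q \<subseteq> \<Omega>1" using \<Omega>1(1) y open_contains_ball by blast
  have "\<bar>push \<Omega>1 S f a - push \<Omega>1 S f b\<bar> \<le> L * C * dist a b"
    if a: "a \<in> ball y (min s q)" and b: "b \<in> ball y (min s q)" for a b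
  proof -
    have in1: "ball y (min s q) \<subseteq> \<Omega>1" using q(2) by auto
    have "norm (S a - S b) \<le> C * norm (a - b)"
    proof (rule differentiable_bound[OF convex_ball[of y "min s q"] _ _ a b])
      show "(S has_derivative D z) (at z within ball y (min s q))" if "z \<in> ball y (min s q)" for z
        using that in1 deriv has_derivative_at_withinI by blast
      show "onorm (D z) \<le> C" if "z \<in> ball y (min s q)" for z
        by (rule onorm_bound[OF C_nonneg deriv_bound]) (use that in1 in blast)
    qed
    moreover have "\<bar>f (S a) - f (S b)\<bar> \<le> L * dist (S a) (S b)"
      using a b s(2)[of a] s(2)[of b] by (intro r(2)) (auto simp: dist_commute)
    ultimately have "\<bar>f (S a) - f (S b)\<bar> \<le> L * (C * dist a b)"
      using mult_left_mono[OF _ L, of "dist (S a) (S b)" "C * dist a b"] by (simp add: dist_norm)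
    moreover have "a \<in> \<Omega>1" "b \<in> \<Omega>1" using a b in1 by blast+
    ultimately show ?thesis by (simp add: push_eq mult.assoc)
  qed
  \<comment> \<open>Radius s keeps images under S inside the Lipschitz ball of f, and q keeps the
    ball inside \<Omega>1, where its convexity allows the mean value inequality for S.\<close>
  moreover have "ball y (min s q) \<subseteq> \<Omega>1" "min s q > 0" using q s(1) by auto
  ultimately show "\<exists>r>0. ball y r \<subseteq> \<Omega>1 \<and> (\<forall>a\<in>ball y r. \<forall>b\<in>ball y r.
      \<bar>push \<Omega>1 S f a - push \<Omega>1 S f b\<bar> \<le> L * C * dist a b)" by blast
next
  have "AE y in lebesgue_on \<Omega>1. y \<in> \<Omega>1" using AE_space[of "lebesgue_on \<Omega>1"] by simp
  with AE_compose[OF fG]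
  show "AE y in lebesgue_on \<Omega>1. (push \<Omega>1 S f has_derivative (\<lambda>h. pull_grad G y \<bullet> h)) (at y)"
  proof eventually_elim
    case (elim y)
    from has_derivative_compose[OF deriv[OF elim(2)] elim(1)]
    have "((\<lambda>z. f (S z)) has_derivative (\<lambda>h. pull_grad G y \<bullet> h)) (at y)"
      by (simp add: inner_pull_grad[OF elim(2)])
    then show ?case
      by (rule has_derivative_transform_within_open[OF _ \<Omega>1(1) elim(2)]) (simp add: push_eq)
  qed
qed

text \<open>Passing to the limit in Lipschitz approximations avoids the Piola identity
  that a direct change of variables in the definition of the weak gradient would need.\<close>

lemma weak_grad_push_limit:
  assumes u: "is_weak_grad \<Omega>0 u G"
    and v: "\<And>n. is_weak_grad \<Omega>0 (v n) (g n)" "\<And>n. is_weak_grad \<Omega>1 (push \<Omega>1 S (v n)) (pull_grad (g n))"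
    and limu: "(\<lambda>n::nat. norm2 (lebesgue_on \<Omega>0) (\<lambda>x. u x - v n x)) \<longlonglongrightarrow> 0"
    and limG: "(\<lambda>n. norm2 (lebesgue_on \<Omega>0) (\<lambda>x. G x - g n x)) \<longlonglongrightarrow> 0"
  shows "is_weak_grad \<Omega>1 (push \<Omega>1 S u) (pull_grad G)"
    and "(\<lambda>n. norm2 (lebesgue_on \<Omega>1) (\<lambda>y. pull_grad G y - pull_grad (g n) y)) \<longlonglongrightarrow> 0"
proof -
  have us: "sq_integrable (lebesgue_on \<Omega>0) u" "sq_integrable (lebesgue_on \<Omega>0) G"
    using u by (auto simp: is_weak_grad_iff \<Omega>_sets)
  have vs: "sq_integrable (lebesgue_on \<Omega>0) (v n)" "sq_integrable (lebesgue_on \<Omega>0) (g n)" for n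
    using v(1)[of n] by (auto simp: is_weak_grad_iff \<Omega>_sets)
  have "norm2 (lebesgue_on \<Omega>1) (\<lambda>y. push \<Omega>1 S u y - push \<Omega>1 S (v n) y)
      = norm2 (lebesgue_on \<Omega>0) (\<lambda>x. u x - v n x)" for n
  proof -
    have "(\<lambda>y. push \<Omega>1 S u y - push \<Omega>1 S (v n) y) = push \<Omega>1 S (\<lambda>x. u x - v n x)"
      by (auto simp: push_def)
    then show ?thesis using sq_integrable_push(2)[OF sq_integrable_diff[OF us(1) vs(1)]] by simp
  qed
  with limu have 1: "(\<lambda>n. norm2 (lebesgue_on \<Omega>1) (\<lambda>y. push \<Omega>1 S u y - push \<Omega>1 S (v n) y)) \<longlonglongrightarrow> 0"
    by simp
  \<comment> \<open>Linearity and L2-boundedness of \<open>pull_grad\<close> carry the convergence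
    of gradients over to \<Omega>1.\<close>
  show 2: "(\<lambda>n. norm2 (lebesgue_on \<Omega>1) (\<lambda>y. pull_grad G y - pull_grad (g n) y)) \<longlonglongrightarrow> 0"
  proof (rule tendsto_sandwich[OF _ _ tendsto_const])
    show "(\<lambda>n. real DIM('a) * C * norm2 (lebesgue_on \<Omega>0) (\<lambda>x. G x - g n x)) \<longlonglongrightarrow> 0"
      by (rule tendsto_mult_right_zero[OF limG])
    show "\<forall>\<^sub>F n in sequentially. norm2 (lebesgue_on \<Omega>1) (\<lambda>y. pull_grad G y - pull_grad (g n) y)
        \<le> real DIM('a) * C * norm2 (lebesgue_on \<Omega>0) (\<lambda>x. G x - g n x)"
      using sq_integrable_pull_grad(2)[OF sq_integrable_diff[OF us(2) vs(2)]]
      by (simp add: pull_grad_diff[abs_def])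
  qed (simp add: norm2_nonneg)
  show "is_weak_grad \<Omega>1 (push \<Omega>1 S u) (pull_grad G)"
    by (rule weak_grad_closed[OF \<Omega>1 sq_integrable_push(1)[OF us(1)] sq_integrable_pull_grad(1)[OF us(2)] v(2) 1 2])
qed

end

subsection \<open>Normalized Lagrange approximation\<close>

lemma set_lebesgue_integral_eq_lebesgue_on:
  fixes f :: "'a::euclidean_space \<Rightarrow> real"
  assumes "open \<Omega>"
  shows "set_lebesgue_integral lebesgue \<Omega> f = integral\<^sup>L (lebesgue_on \<Omega>) f"
  using open_in_sets_lebesgue[OF assms] by (simp add: set_lebesgue_integral_def integral_restrict_space)

lemma weak_grad_wgrad: "is_weak_grad \<Omega> u G \<Longrightarrow> is_weak_grad \<Omega> u (wgrad \<Omega> u)"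
  unfolding wgrad_def by (rule someI[of "is_weak_grad \<Omega> u"])

lemma weak_grad_sq_integrable:
  assumes "open \<Omega>" "is_weak_grad \<Omega> u G"
  shows "sq_integrable (lebesgue_on \<Omega>) u" "sq_integrable (lebesgue_on \<Omega>) G"
  using assms by (auto simp: is_weak_grad_iff open_in_sets_lebesgue)

text \<open>By uniqueness almost everywhere, energies may be computed with whichever weak gradient
  is at hand.\<close>

lemma norm2_wgrad:
  assumes \<Omega>: "open \<Omega>" "bounded \<Omega>" and G: "is_weak_grad \<Omega> u G"
  shows "norm2 (lebesgue_on \<Omega>) (wgrad \<Omega> u) = norm2 (lebesgue_on \<Omega>) G"
  using weak_grad_sq_integrable(2)[OF \<Omega>(1)] G weak_grad_wgrad[OF G] weak_grad_unique[OF \<Omega> weak_grad_wgrad[OF G] G]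
  by (intro norm2_cong_AE) auto

lemma dirform_eq:
  assumes "open \<Omega>"
  shows "dirform \<Omega> u u = (norm2 (lebesgue_on \<Omega>) (wgrad \<Omega> u))\<^sup>2"
  by (simp add: dirform_def set_lebesgue_integral_eq_lebesgue_on[OF assms] norm2_power2 power2_norm_eq_inner)

lemma L2norm_eq:
  assumes "open \<Omega>"
  shows "L2norm \<Omega> u = norm2 (lebesgue_on \<Omega>) u"
  by (simp add: L2norm_def set_lebesgue_integral_eq_lebesgue_on[OF assms] norm2_def)

text \<open>The squared H1 norm is the sum of both squares; splitting the integral is legitimate
  because the existence of a weak gradient makes each summand integrable.\<close>

lemma norm2_le_H1norm:
  assumes \<Omega>: "open \<Omega>" "bounded \<Omega>" and G: "is_weak_grad \<Omega> u G"
  shows "norm2 (lebesgue_on \<Omega>) u \<le> H1norm \<Omega> u" "norm2 (lebesgue_on \<Omega>) G \<le> H1norm \<Omega> u"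
proof -
  let ?M = "lebesgue_on \<Omega>"
  have i: "integrable ?M (\<lambda>x. (norm (u x))\<^sup>2)" "integrable ?M (\<lambda>x. (norm (wgrad \<Omega> u x))\<^sup>2)"
    using weak_grad_sq_integrable[OF \<Omega>(1) weak_grad_wgrad[OF G]] by (simp_all add: sq_integrable_def)
  have "(H1norm \<Omega> u)\<^sup>2 = (\<integral>x. (norm (u x))\<^sup>2 + (norm (wgrad \<Omega> u x))\<^sup>2 \<partial>?M)"
    by (simp add: H1norm_def set_lebesgue_integral_eq_lebesgue_on[OF \<Omega>(1)])
  also have "\<dots> = (norm2 ?M u)\<^sup>2 + (norm2 ?M G)\<^sup>2"
    unfolding norm2_wgrad[OF \<Omega> G, symmetric] norm2_power2
    by (rule Bochner_Integration.integral_add[OF i])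
  finally have eq: "(H1norm \<Omega> u)\<^sup>2 = (norm2 ?M u)\<^sup>2 + (norm2 ?M G)\<^sup>2" .
  have "0 \<le> (\<integral>x. (norm (u x))\<^sup>2 + (norm (wgrad \<Omega> u x))\<^sup>2 \<partial>?M)" by simp
  then have nn: "0 \<le> H1norm \<Omega> u"
    by (simp add: H1norm_def set_lebesgue_integral_eq_lebesgue_on[OF \<Omega>(1)])
  show "norm2 ?M u \<le> H1norm \<Omega> u" "norm2 ?M G \<le> H1norm \<Omega> u"
    by (rule power2_le_imp_le[OF _ nn]; simp add: eq)+
qed

lemma atilde_nonneg: "open \<Omega>0 \<Longrightarrow> open \<Omega>1 \<Longrightarrow> 0 \<le> atilde \<Omega>0 \<Omega>1 S J u u"
  by (simp add: atilde_def dirform_eq)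

lemma lagrange_space_weak_grad:
  assumes "open \<Omega>" "bounded \<Omega>" "triangulation \<Omega> \<T>" "v \<in> lagrange_space \<T> k \<Omega>"
  shows "\<exists>g. is_weak_grad \<Omega> v g"
proof -
  obtain B L g where *: "\<And>x. x \<in> \<Omega> \<Longrightarrow> \<bar>v x\<bar> \<le> B" "L \<ge> 0"
    "\<And>x. x \<in> \<Omega> \<Longrightarrow> \<exists>r>0. ball x r \<subseteq> \<Omega> \<and> (\<forall>y\<in>ball x r. \<forall>z\<in>ball x r. \<bar>v y - v z\<bar> \<le> L * dist y z)"
    "AE x in lebesgue_on \<Omega>. (v has_derivative (\<lambda>h. g x \<bullet> h)) (at x)"
    by (rule lagrange_space_regularity[OF assms]) (rule that)
  from weak_grad_of_locally_Lipschitz[OF assms(1,2) *(1,3,4)] show ?thesis by blast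
qed

context volume_preserving_map
begin

lemma aform_eq:
  assumes "is_weak_grad \<Omega>0 u G" "is_weak_grad \<Omega>1 (push \<Omega>1 S u) (pull_grad G)"
  shows "aform \<Omega>0 \<Omega>1 S u u
    = ((norm2 (lebesgue_on \<Omega>0) G)\<^sup>2 + (norm2 (lebesgue_on \<Omega>1) (pull_grad G))\<^sup>2) / 2"
  unfolding aform_def dirform_eq[OF \<Omega>0(1)] dirform_eq[OF \<Omega>1(1)] norm2_wgrad[OF \<Omega>0 assms(1)]
    norm2_wgrad[OF \<Omega>1 assms(2)] ..

lemma lagrange_space_push_weak_grad:
  assumes tri: "triangulation \<Omega>0 \<T>" and v: "v \<in> lagrange_space \<T> k \<Omega>0"
  shows "\<exists>g. is_weak_grad \<Omega>0 v g \<and> is_weak_grad \<Omega>1 (push \<Omega>1 S v) (pull_grad g)"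
proof -
  obtain B L g where *: "\<And>x. x \<in> \<Omega>0 \<Longrightarrow> \<bar>v x\<bar> \<le> B" "L \<ge> 0"
    "\<And>x. x \<in> \<Omega>0 \<Longrightarrow> \<exists>r>0. ball x r \<subseteq> \<Omega>0 \<and> (\<forall>y\<in>ball x r. \<forall>z\<in>ball x r. \<bar>v y - v z\<bar> \<le> L * dist y z)"
    "AE x in lebesgue_on \<Omega>0. (v has_derivative (\<lambda>h. g x \<bullet> h)) (at x)"
    by (rule lagrange_space_regularity[OF \<Omega>0 tri v]) (rule that)
  have "is_weak_grad \<Omega>0 v g" by (rule weak_grad_of_locally_Lipschitz[OF \<Omega>0 *(1,3,4)])
  moreover have "is_weak_grad \<Omega>1 (push \<Omega>1 S v) (pull_grad g)"
    by (rule weak_grad_push_of_locally_Lipschitz[OF *])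
  ultimately show ?thesis by blast
qed

text \<open>On the open domain this is the constant 1, so the Lipschitz lemmas apply with L =
  0.\<close>

lemma indicator_weak_grad:
  shows "is_weak_grad \<Omega>0 (indicator (closure \<Omega>0)) (\<lambda>_. 0)"
    and "is_weak_grad \<Omega>1 (push \<Omega>1 S (indicator (closure \<Omega>0))) (pull_grad (\<lambda>_. 0))"
proof -
  let ?e = "indicator (closure \<Omega>0) :: 'a \<Rightarrow> real"
  have e1: "?e x = 1" if "x \<in> \<Omega>0" for x using that closure_subset by (auto simp: indicator_def)
  have B: "\<bar>?e x\<bar> \<le> 1" if "x \<in> \<Omega>0" for x using e1[OF that] by simp
  have lip: "\<exists>r>0. ball x r \<subseteq> \<Omega>0 \<and> (\<forall>y\<in>ball x r. \<forall>z\<in>ball x r. \<bar>?e y - ?e z\<bar> \<le> 0 * dist y z)"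
    if x: "x \<in> \<Omega>0" for x
  proof -
    obtain r where r: "r > 0" "ball x r \<subseteq> \<Omega>0" using \<Omega>0(1) x open_contains_ball by blast
    have "?e y = 1" if "y \<in> ball x r" for y using e1 that r(2) by blast
    with r show ?thesis by (intro exI[of _ r]) simp
  qed
  have "(?e has_derivative (\<lambda>h. 0 \<bullet> h)) (at x)" if x: "x \<in> \<Omega>0" for x
  proof (rule has_derivative_transform_within_open[OF _ \<Omega>0(1) x])
    show "((\<lambda>_. 1) has_derivative (\<lambda>h. 0 \<bullet> h)) (at x)" by simp
  qed (simp add: e1)
  then have d: "AE x in lebesgue_on \<Omega>0. (?e has_derivative (\<lambda>h. 0 \<bullet> h)) (at x)"
    by (intro AE_I2) simp
  show "is_weak_grad \<Omega>0 ?e (\<lambda>_. 0)" by (rule weak_grad_of_locally_Lipschitz[OF \<Omega>0 B lip d])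
  show "is_weak_grad \<Omega>1 (push \<Omega>1 S ?e) (pull_grad (\<lambda>_. 0))"
    by (rule weak_grad_push_of_locally_Lipschitz[OF B order_refl lip d])
qed

lemma affine_weak_grad:
  fixes a b :: real
  assumes v: "is_weak_grad \<Omega>0 v g" "is_weak_grad \<Omega>1 (push \<Omega>1 S v) (pull_grad g)"
  defines "z \<equiv> \<lambda>x. a * v x + b * indicator (closure \<Omega>0) x"
  shows "is_weak_grad \<Omega>0 z (\<lambda>x. a *\<^sub>R g x)"
    and "is_weak_grad \<Omega>1 (push \<Omega>1 S z) (pull_grad (\<lambda>x. a *\<^sub>R g x))"
proof -
  show "is_weak_grad \<Omega>0 z (\<lambda>x. a *\<^sub>R g x)"
    using weak_grad_linear_combination[OF \<Omega>0 v(1) indicator_weak_grad(1), of a b] by (simp add: z_def)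
  have "push \<Omega>1 S z = (\<lambda>y. a * push \<Omega>1 S v y + b * push \<Omega>1 S (indicator (closure \<Omega>0)) y)"
    by (auto simp: push_def z_def)
  moreover have "pull_grad (\<lambda>x. a *\<^sub>R g x) = (\<lambda>y. a *\<^sub>R pull_grad g y + b *\<^sub>R pull_grad (\<lambda>_. 0) y)"
    by (simp add: pull_grad_def[abs_def] scaleR_sum_right)
  ultimately show "is_weak_grad \<Omega>1 (push \<Omega>1 S z) (pull_grad (\<lambda>x. a *\<^sub>R g x))"
    using weak_grad_linear_combination[OF \<Omega>1 v(2) indicator_weak_grad(2), of a b] by simp
qed

text \<open>Approximate v by Lagrange functions w_n, subtract the mean c_n and divide by the norm
  s_n. Since v has mean 0 and norm 1, c_n tends to 0 and s_n to 1. The gradient merely acquires the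
  factor 1 / s_n, so the energies converge to that of v and some late member of the sequence serves
  as z.\<close>

lemma normalized_approximation:
  assumes ne: "\<Omega>0 \<noteq> {}"
    and v: "v \<in> H1 \<Omega>0" "mean_zero \<Omega>0 v" "L2norm \<Omega>0 v = 1"
    and tri: "\<And>h. h \<in> H \<Longrightarrow> triangulation \<Omega>0 (\<T> h)"
    and dense: "\<And>\<epsilon>. \<epsilon> > 0 \<Longrightarrow> \<exists>h\<in>H. \<exists>w\<in>lagrange_space (\<T> h) k \<Omega>0. H1norm \<Omega>0 (\<lambda>x. v x - w x) < \<epsilon>"
    and \<epsilon>: "\<epsilon> > 0"
  shows "\<exists>h\<in>H. \<exists>z\<in>lagrange_space (\<T> h) k \<Omega>0. mean_zero \<Omega>0 z \<and> L2norm \<Omega>0 z = 1 \<and>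
    aform \<Omega>0 \<Omega>1 S z z < aform \<Omega>0 \<Omega>1 S v v + \<epsilon>"
proof -
  let ?M = "lebesgue_on \<Omega>0"
  let ?e = "indicator (closure \<Omega>0) :: 'a \<Rightarrow> real"
  have fin: "finite_measure ?M" by (rule finite_measure_lebesgue_on[OF \<Omega>0])
  obtain G where G: "is_weak_grad \<Omega>0 v G" using v(1) by (auto simp: H1_def)
  note vs = weak_grad_sq_integrable[OF \<Omega>0(1) G]
  have "\<exists>h w. h \<in> H \<and> w \<in> lagrange_space (\<T> h) k \<Omega>0 \<and> H1norm \<Omega>0 (\<lambda>x. v x - w x) < inverse (real (Suc n))" for n
    using dense[of "inverse (real (Suc n))"] by fastforce
  then obtain h w where h: "\<And>n. h n \<in> H" and w: "\<And>n. w n \<in> lagrange_space (\<T> (h n)) k \<Omega>0"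
    and close: "\<And>n. H1norm \<Omega>0 (\<lambda>x. v x - w n x) < inverse (real (Suc n))" by metis
  have "\<exists>g. is_weak_grad \<Omega>0 (w n) g \<and> is_weak_grad \<Omega>1 (push \<Omega>1 S (w n)) (pull_grad g)" for n
    by (rule lagrange_space_push_weak_grad[OF tri[OF h] w])
  then obtain g where g: "\<And>n. is_weak_grad \<Omega>0 (w n) (g n)"
    "\<And>n. is_weak_grad \<Omega>1 (push \<Omega>1 S (w n)) (pull_grad (g n))" by metis
  note ws = weak_grad_sq_integrable[OF \<Omega>0(1) g(1)]
  have diff: "is_weak_grad \<Omega>0 (\<lambda>x. v x - w n x) (\<lambda>x. G x - g n x)" for n
    using weak_grad_linear_combination[OF \<Omega>0 G g(1), of 1 "-1" n] by simp
  have lim0: "(\<lambda>n. norm2 ?M (\<lambda>x. v x - w n x)) \<longlonglongrightarrow> 0" "(\<lambda>n. norm2 ?M (\<lambda>x. G x - g n x)) \<longlonglongrightarrow> 0"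
    using norm2_le_H1norm[OF \<Omega>0 diff] close
    by (intro tendsto_sandwich[OF _ _ tendsto_const LIMSEQ_inverse_real_of_nat] always_eventually allI
        norm2_nonneg; meson less_imp_le order_trans)+
  note push_limit = weak_grad_push_limit[OF G g lim0]
  have limG: "(\<lambda>n. norm2 ?M (g n)) \<longlonglongrightarrow> norm2 ?M G"
    using lim0(2) by (intro norm2_tendsto ws vs) (simp add: norm2_def norm_minus_commute)
  have limP: "(\<lambda>n. norm2 (lebesgue_on \<Omega>1) (pull_grad (g n))) \<longlonglongrightarrow> norm2 (lebesgue_on \<Omega>1) (pull_grad G)"
    using push_limit(2) by (intro norm2_tendsto sq_integrable_pull_grad ws vs) (simp add: norm2_def norm_minus_commute)
  define m where "m = measure lebesgue \<Omega>0"
  have m: "m > 0"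
  proof -
    have "\<not> negligible \<Omega>0" using ne \<Omega>0(1) open_not_negligible by blast
    moreover have "\<Omega>0 \<in> lmeasurable" using \<Omega>0 by (simp add: lmeasurable_open)
    ultimately show ?thesis unfolding m_def
      by (metis negligible_iff_measure0 measure_nonneg order_le_less)
  qed
  have e1: "?e x = 1" if "x \<in> \<Omega>0" for x using that closure_subset by (auto simp: indicator_def)
  have es: "sq_integrable ?M ?e" by (rule weak_grad_sq_integrable[OF \<Omega>0(1) indicator_weak_grad(1)])
  have ie: "(\<integral>x. ?e x \<partial>?M) = m"
  proof -
    have "(\<integral>x. ?e x \<partial>?M) = (\<integral>x. 1 \<partial>?M)"
      by (rule Bochner_Integration.integral_cong) (auto simp: e1)
    then show ?thesis using \<Omega>_sets(1) by (simp add: m_def measure_restrict_space)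
  qed
  define c where "c n = (\<integral>x. w n x \<partial>?M) / m" for n
  have c0: "c \<longlonglongrightarrow> 0"
  proof (rule Lim_null_comparison)
    show "(\<lambda>n. norm2 ?M (\<lambda>x. v x - w n x) * norm2 ?M ?e / m) \<longlonglongrightarrow> 0"
      using tendsto_mult_left_zero[OF lim0(1), of "norm2 ?M ?e / m"] by simp
    show "\<forall>\<^sub>F n in sequentially. norm (c n) \<le> norm2 ?M (\<lambda>x. v x - w n x) * norm2 ?M ?e / m"
    proof (intro always_eventually allI)
      fix n
      have vi: "integrable ?M v" "integrable ?M (w n)"
        using sq_integrable_imp_integrable[OF fin] vs(1) ws(1) by blast+
      \<comment> \<open>As v has mean zero, the mean of w_n is up to sign the pairing of v - w_n
        with the constant 1, and Cauchy-Schwarz controls it.\<close>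
      have "(\<integral>x. (v x - w n x) \<bullet> ?e x \<partial>?M) = (\<integral>x. v x - w n x \<partial>?M)"
        by (rule Bochner_Integration.integral_cong) (auto simp: e1)
      also have "\<dots> = - (\<integral>x. w n x \<partial>?M)"
        using v(2) vi by (simp add: mean_zero_def set_lebesgue_integral_eq_lebesgue_on[OF \<Omega>0(1)])
      finally have "\<bar>\<integral>x. w n x \<partial>?M\<bar> \<le> norm2 ?M (\<lambda>x. v x - w n x) * norm2 ?M ?e"
        using Cauchy_Schwarz_norm2[OF sq_integrable_diff[OF vs(1) ws(1)] es, of n] by simp
      then show "norm (c n) \<le> norm2 ?M (\<lambda>x. v x - w n x) * norm2 ?M ?e / m"
        using m by (simp add: c_def abs_divide divide_right_mono)
    qed
  qed
  define s where "s n = norm2 ?M (\<lambda>x. w n x - c n * ?e x)" for n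
  have we: "sq_integrable ?M (\<lambda>x. w n x - c n * ?e x)" for n
    using sq_integrable_diff[OF ws(1) sq_integrable_scaleR[OF es], of n "c n"] by simp
  have s1: "s \<longlonglongrightarrow> 1"
  proof -
    have "(\<lambda>n. norm2 ?M (\<lambda>x. (w n x - c n * ?e x) - v x)) \<longlonglongrightarrow> 0"
    proof (rule tendsto_sandwich[OF _ _ tendsto_const])
      show "(\<lambda>n. norm2 ?M (\<lambda>x. v x - w n x) + \<bar>c n\<bar> * norm2 ?M ?e) \<longlonglongrightarrow> 0"
        using tendsto_add[OF lim0(1) tendsto_mult_left_zero[OF tendsto_rabs_zero[OF c0], of "norm2 ?M ?e"]] by simp
      have "norm2 ?M (\<lambda>x. (w n x - c n * ?e x) - v x) \<le> norm2 ?M (\<lambda>x. v x - w n x) + \<bar>c n\<bar> * norm2 ?M ?e" for n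
      proof -
        have "norm2 ?M (\<lambda>x. (w n x - c n * ?e x) - v x) = norm2 ?M (\<lambda>x. (v x - w n x) + c n *\<^sub>R ?e x)"
          unfolding norm2_def by (simp add: power2_eq_square algebra_simps)
        also have "\<dots> \<le> norm2 ?M (\<lambda>x. v x - w n x) + norm2 ?M (\<lambda>x. c n *\<^sub>R ?e x)"
          by (intro norm2_triangle sq_integrable_diff vs ws sq_integrable_scaleR es)
        finally show ?thesis by (simp only: norm2_scaleR)
      qed
      then show "\<forall>\<^sub>F n in sequentially. norm2 ?M (\<lambda>x. (w n x - c n * ?e x) - v x)
          \<le> norm2 ?M (\<lambda>x. v x - w n x) + \<bar>c n\<bar> * norm2 ?M ?e" by simp
    qed (simp add: norm2_nonneg)
    from norm2_tendsto[OF we vs(1) this] v(3) show ?thesis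
      by (simp add: s_def[abs_def] L2norm_eq[OF \<Omega>0(1)])
  qed
  \<comment> \<open>If \<open>s n = 0\<close> this is the default value 0 and normalization fails;
    the index picked at the end has \<open>s n > 0\<close>.\<close>
  define a where "a n = inverse (s n)" for n
  have a1: "a \<longlonglongrightarrow> 1" unfolding a_def using tendsto_inverse[OF s1] by simp
  define z where "z n = (\<lambda>x. a n * w n x + (- a n * c n) * ?e x)" for n
  have zg: "is_weak_grad \<Omega>0 (z n) (\<lambda>x. a n *\<^sub>R g n x)"
      "is_weak_grad \<Omega>1 (push \<Omega>1 S (z n)) (pull_grad (\<lambda>x. a n *\<^sub>R g n x))" for n
    unfolding z_def by (rule affine_weak_grad[OF g(1) g(2)])+
  have az: "aform \<Omega>0 \<Omega>1 S (z n) (z n)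
      = (a n)\<^sup>2 * (((norm2 ?M (g n))\<^sup>2 + (norm2 (lebesgue_on \<Omega>1) (pull_grad (g n)))\<^sup>2) / 2)" for n
  proof -
    have "pull_grad (\<lambda>x. a n *\<^sub>R g n x) = (\<lambda>y. a n *\<^sub>R pull_grad (g n) y)"
      by (simp add: pull_grad_def[abs_def] scaleR_sum_right)
    then show ?thesis
      using aform_eq[OF zg] by (simp add: norm2_scaleR power_mult_distrib distrib_left)
  qed
  have "(\<lambda>n. aform \<Omega>0 \<Omega>1 S (z n) (z n)) \<longlonglongrightarrow> 1\<^sup>2 * (((norm2 ?M G)\<^sup>2 + (norm2 (lebesgue_on \<Omega>1) (pull_grad G))\<^sup>2) / 2)"
    unfolding az by (intro tendsto_intros a1 limG limP) simp
  then have "(\<lambda>n. aform \<Omega>0 \<Omega>1 S (z n) (z n)) \<longlonglongrightarrow> aform \<Omega>0 \<Omega>1 S v v"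
    by (simp add: aform_eq[OF G push_limit(1)])
  then have "\<forall>\<^sub>F n in sequentially. aform \<Omega>0 \<Omega>1 S (z n) (z n) < aform \<Omega>0 \<Omega>1 S v v + \<epsilon>"
    by (rule order_tendstoD) (use \<epsilon> in simp)
  moreover have "\<forall>\<^sub>F n in sequentially. s n > 0" by (rule order_tendstoD(1)[OF s1]) simp
  ultimately have "\<forall>\<^sub>F n in sequentially. aform \<Omega>0 \<Omega>1 S (z n) (z n) < aform \<Omega>0 \<Omega>1 S v v + \<epsilon> \<and> s n > 0"
    by (rule eventually_conj)
  then obtain n where n: "aform \<Omega>0 \<Omega>1 S (z n) (z n) < aform \<Omega>0 \<Omega>1 S v v + \<epsilon>" "s n > 0"
    by (auto simp: eventually_sequentially)
  have zeq: "z n x = a n *\<^sub>R (w n x - c n * ?e x)" for x by (simp add: z_def algebra_simps)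
  have "\<Union>(\<T> (h n)) = closure \<Omega>0" using tri[OF h] by (simp add: triangulation_def)
  then have "z n \<in> lagrange_space (\<T> (h n)) k \<Omega>0"
    unfolding z_def by (rule lagrange_space_affine[OF w])
  moreover have "mean_zero \<Omega>0 (z n)"
  proof -
    have "integrable ?M (w n)" "integrable ?M ?e"
      using sq_integrable_imp_integrable[OF fin] es ws(1) by blast+
    then have "(\<integral>x. z n x \<partial>?M) = a n * ((\<integral>x. w n x \<partial>?M) - c n * m)"
      using ie unfolding zeq by simp
    also have "\<dots> = 0" using m by (simp add: c_def)
    finally show ?thesis by (simp add: mean_zero_def set_lebesgue_integral_eq_lebesgue_on[OF \<Omega>0(1)])
  qed
  moreover have "L2norm \<Omega>0 (z n) = 1"
    unfolding L2norm_eq[OF \<Omega>0(1)] zeq norm2_scaleR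
    using n(2) by (simp add: a_def flip: s_def)
  ultimately show ?thesis using h[of n] n(1) by blast
qed

end

subsection \<open>Convergence of the discrete forms\<close>

text \<open>Only the form on \<Omega>1 varies with h. By the reverse triangle inequality its
  gradient norm deviates by at most the H1 error. Eventual membership in H1 is required because
  \<open>wgrad\<close> of other functions is arbitrary.\<close>

lemma atilde_tendsto:
  assumes \<Omega>: "open \<Omega>0" "open \<Omega>1" "bounded \<Omega>1"
    and z: "is_weak_grad \<Omega>1 (push \<Omega>1 S z) \<gamma>"
    and J: "\<forall>\<^sub>F h in F. J h (push \<Omega>1 S z) \<in> H1 \<Omega>1"
    and lim: "((\<lambda>h. H1norm \<Omega>1 (\<lambda>y. J h (push \<Omega>1 S z) y - push \<Omega>1 S z y)) \<longlongrightarrow> 0) F"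
  shows "((\<lambda>h. atilde \<Omega>0 \<Omega>1 S (J h) z z) \<longlongrightarrow> aform \<Omega>0 \<Omega>1 S z z) F"
proof -
  let ?p = "push \<Omega>1 S z" and ?M = "lebesgue_on \<Omega>1"
  have "((\<lambda>h. norm2 ?M (wgrad \<Omega>1 (J h ?p))) \<longlongrightarrow> norm2 ?M (wgrad \<Omega>1 ?p)) F"
  proof (rule LIM_zero_cancel, rule Lim_null_comparison[OF _ lim])
    show "\<forall>\<^sub>F h in F. norm (norm2 ?M (wgrad \<Omega>1 (J h ?p)) - norm2 ?M (wgrad \<Omega>1 ?p))
        \<le> H1norm \<Omega>1 (\<lambda>y. J h ?p y - ?p y)"
      using J
    proof eventually_elim
      case (elim h)
      then have w: "is_weak_grad \<Omega>1 (J h ?p) (wgrad \<Omega>1 (J h ?p))" "is_weak_grad \<Omega>1 ?p (wgrad \<Omega>1 ?p)"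
        using weak_grad_wgrad z by (auto simp: H1_def)
      have "is_weak_grad \<Omega>1 (\<lambda>y. J h ?p y - ?p y) (\<lambda>y. wgrad \<Omega>1 (J h ?p) y - wgrad \<Omega>1 ?p y)"
        using weak_grad_linear_combination[OF \<Omega>(2,3) w, of 1 "-1"] by simp
      from norm2_le_H1norm(2)[OF \<Omega>(2,3) this]
        norm2_triangle_diff[OF weak_grad_sq_integrable(2)[OF \<Omega>(2) w(1)] weak_grad_sq_integrable(2)[OF \<Omega>(2) w(2)]]
      show ?case by simp
    qed
  qed
  then show ?thesis
    unfolding atilde_def aform_def dirform_eq[OF \<Omega>(2)] by (intro tendsto_intros) auto
qed

text \<open>The filter \<open>at 0 within H\<close> bounds the upper limit along every sequence of
  mesh sizes tending to 0 at once. Values are embedded in \<open>ereal\<close>, a complete lattice,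
  so the upper limit exists before any bound is known.\<close>

theorem theorem1:
  fixes \<Omega>0 \<Omega>1 :: "'a::euclidean_space set"
    and T Tinv :: "'a \<Rightarrow> 'a"
    and H :: "real set"
    and \<T>0 \<T>1 :: "real \<Rightarrow> 'a set set"
    and k k' :: nat
    and I :: "real \<Rightarrow> ('a \<Rightarrow> real) \<Rightarrow> ('a \<Rightarrow> real)"
  assumes dim: "DIM('a) = 2 \<or> DIM('a) = 3"
    and dom0: "polyhedral_domain \<Omega>0" and dom1: "polyhedral_domain \<Omega>1"
    and T_img: "T ` \<Omega>0 = \<Omega>1" and Tinv_img: "Tinv ` \<Omega>1 = \<Omega>0"
    and T_inv1: "\<forall>x\<in>\<Omega>0. Tinv (T x) = x" and T_inv2: "\<forall>y\<in>\<Omega>1. T (Tinv y) = y"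
    and T_ext: "\<exists>U T'. open U \<and> closure \<Omega>0 \<subseteq> U \<and> smooth_map_on U T' \<and> (\<forall>x\<in>\<Omega>0. T' x = T x)"
    and Tinv_ext: "\<exists>U T'. open U \<and> closure \<Omega>1 \<subseteq> U \<and> smooth_map_on U T' \<and> (\<forall>y\<in>\<Omega>1. T' y = Tinv y)"
    and vol: "\<forall>A\<in>sets lebesgue. A \<subseteq> \<Omega>0 \<longrightarrow>
               T ` A \<in> sets lebesgue \<and> emeasure lebesgue (T ` A) = emeasure lebesgue A"
    and H_pos: "H \<subseteq> {0<..}" and H_lim: "0 islimpt H"
    and k_pos: "k \<ge> 1" and k'_pos: "k' \<ge> 1"
    and qu0: "quasi_uniform H \<Omega>0 \<T>0" and qu1: "quasi_uniform H \<Omega>1 \<T>1"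
    and nested: "\<forall>h\<in>H. \<forall>h'\<in>H. h < h' \<longrightarrow>
                   lagrange_space (\<T>0 h') k \<Omega>0 \<subseteq> lagrange_space (\<T>0 h) k \<Omega>0"
    and dense: "\<forall>u\<in>H1 \<Omega>0. \<forall>\<epsilon>>0. \<exists>h\<in>H. \<exists>v\<in>lagrange_space (\<T>0 h) k \<Omega>0.
                   H1norm \<Omega>0 (\<lambda>x. u x - v x) < \<epsilon>"
    and I_maps: "\<forall>h\<in>H. \<forall>f\<in>lagrange_space (\<T>0 h) k \<Omega>0.
                   I h (push \<Omega>1 Tinv f) \<in> lagrange_space (\<T>1 h) k' \<Omega>1"
    and I_lin: "\<forall>h\<in>H. \<forall>f\<in>lagrange_space (\<T>0 h) k \<Omega>0. \<forall>g\<in>lagrange_space (\<T>0 h) k \<Omega>0. \<forall>a b::real.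
                   I h (push \<Omega>1 Tinv (\<lambda>x. a * f x + b * g x))
                     = (\<lambda>y. a * I h (push \<Omega>1 Tinv f) y + b * I h (push \<Omega>1 Tinv g) y)"
    and H1_conv: "\<forall>f\<in>(\<Union>h\<in>H. lagrange_space (\<T>0 h) k \<Omega>0).
                   ((\<lambda>h. H1norm \<Omega>1 (\<lambda>y. I h (push \<Omega>1 Tinv f) y - push \<Omega>1 Tinv f y)) \<longlongrightarrow> 0)
                     (at 0 within H)"
  shows "Limsup (at 0 within H)
           (\<lambda>h. ereal (lambda_tilde \<Omega>0 \<Omega>1 Tinv (I h) (lagrange_space (\<T>0 h) k \<Omega>0)))
         \<le> ereal (lambda1 \<Omega>0 \<Omega>1 Tinv)"
proof -
  have \<Omega>: "open \<Omega>0" "bounded \<Omega>0" "\<Omega>0 \<noteq> {}" "open \<Omega>1" "bounded \<Omega>1"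
    using dom0 dom1 by (auto simp: polyhedral_domain_def)
  obtain U T' where U: "open U" "closure \<Omega>1 \<subseteq> U" "smooth_map_on U T'" "\<And>y. y \<in> \<Omega>1 \<Longrightarrow> T' y = Tinv y"
    using Tinv_ext by blast
  \<comment> \<open>The derivative is taken from the smooth extension, which on the open set
    \<Omega>1 agrees with \<open>Tinv\<close>; compactness of the closure gives the uniform bound
    C.\<close>
  have "compact (closure \<Omega>1)" using \<Omega>(5) by (simp add: compact_closure)
  then obtain D C where D: "\<And>y. y \<in> U \<Longrightarrow> (T' has_derivative D y) (at y)"
    "\<And>i. i \<in> Basis \<Longrightarrow> continuous_on U (\<lambda>y. D y i)"
    "C \<ge> 0" "\<And>y h. y \<in> closure \<Omega>1 \<Longrightarrow> norm (D y h) \<le> C * norm h"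
    by (rule smooth_map_derivative[OF U(1,3) _ U(2)]) (rule that)
  have \<Omega>1U: "\<Omega>1 \<subseteq> U" "\<Omega>1 \<subseteq> closure \<Omega>1" using U(2) closure_subset by blast+
  interpret volume_preserving_map \<Omega>0 \<Omega>1 T Tinv D C
  proof
    show "(Tinv has_derivative D y) (at y)" if "y \<in> \<Omega>1" for y
      by (rule has_derivative_transform_within_open[OF D(1) \<Omega>(4) that]) (use that \<Omega>1U U(4) in auto)
    show "continuous_on \<Omega>1 (\<lambda>y. D y i)" if "i \<in> Basis" for i
      by (rule continuous_on_subset[OF D(2)[OF that] \<Omega>1U(1)])
    show "norm (D y h) \<le> C * norm h" if "y \<in> \<Omega>1" for y h
      by (rule D(4)) (use that \<Omega>1U in blast)
    show "T ` A \<in> sets lebesgue \<and> emeasure lebesgue (T ` A) = emeasure lebesgue A"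
      if "A \<in> sets lebesgue" "A \<subseteq> \<Omega>0" for A
      using vol that by blast
    show "Tinv (T x) = x" if "x \<in> \<Omega>0" for x using T_inv1 that by blast
    show "T (Tinv y) = y" if "y \<in> \<Omega>1" for y using T_inv2 that by blast
  qed (fact \<Omega> T_img Tinv_img D(3))+
  let ?S = "\<lambda>h. lagrange_space (\<T>0 h) k \<Omega>0"
  let ?adm = "\<lambda>v. mean_zero \<Omega>0 v \<and> L2norm \<Omega>0 v = 1"
  let ?\<Lambda> = "\<lambda>h. lambda_tilde \<Omega>0 \<Omega>1 Tinv (I h) (?S h)"
  have tri0: "triangulation \<Omega>0 (\<T>0 h)" and tri1: "triangulation \<Omega>1 (\<T>1 h)" if "h \<in> H" for h
    using qu0 qu1 that by (auto simp: quasi_uniform_def)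
  have inH: "\<forall>\<^sub>F h in at 0 within H. h \<in> H" by (simp add: eventually_at_filter)
  have S_H1: "v \<in> H1 \<Omega>0" if "h \<in> H" "v \<in> ?S h" for h v
    using lagrange_space_weak_grad[OF \<Omega>(1,2) tri0[OF that(1)] that(2)] by (simp add: H1_def)
  \<comment> \<open>Each admissible v alone yields an eventual bound; the infimum over v is taken
    only afterwards, so the threshold in h may depend on v.\<close>
  have upper: "\<forall>\<^sub>F h in at 0 within H. ?\<Lambda> h < aform \<Omega>0 \<Omega>1 Tinv v v + \<epsilon>"
    if v: "v \<in> H1 \<Omega>0" "?adm v" and \<epsilon>: "\<epsilon> > 0" for v \<epsilon>
  proof -
    have d: "\<exists>h\<in>H. \<exists>w\<in>?S h. H1norm \<Omega>0 (\<lambda>x. v x - w x) < \<delta>" if "\<delta> > 0" for \<delta>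
      using dense v(1) that by blast
    obtain h0 z where h0: "h0 \<in> H" and z: "z \<in> ?S h0" "?adm z"
      and az: "aform \<Omega>0 \<Omega>1 Tinv z z < aform \<Omega>0 \<Omega>1 Tinv v v + \<epsilon>"
      using normalized_approximation[OF \<Omega>(3) v(1) conjunct1[OF v(2)] conjunct2[OF v(2)] tri0 d \<epsilon>] by blast
    have "h0 > 0" using h0 H_pos by auto
    \<comment> \<open>Nestedness concerns strictly smaller mesh sizes, and these are all that remain
      near 0.\<close>
    then have "\<forall>\<^sub>F h in at 0 within H. h < h0"
      unfolding eventually_at by (auto simp: dist_real_def intro!: exI[of _ h0])
    with inH have zS: "\<forall>\<^sub>F h in at 0 within H. h \<in> H \<and> z \<in> ?S h"
      by eventually_elim (use nested h0 z(1) in blast)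
    obtain g where g: "is_weak_grad \<Omega>1 (push \<Omega>1 Tinv z) (pull_grad g)"
      using lagrange_space_push_weak_grad[OF tri0[OF h0] z(1)] by blast
    have "((\<lambda>h. atilde \<Omega>0 \<Omega>1 Tinv (I h) z z) \<longlongrightarrow> aform \<Omega>0 \<Omega>1 Tinv z z) (at 0 within H)"
    proof (rule atilde_tendsto[OF \<Omega>(1,4,5) g])
      show "\<forall>\<^sub>F h in at 0 within H. I h (push \<Omega>1 Tinv z) \<in> H1 \<Omega>1"
        using zS
      proof eventually_elim
        case (elim h)
        then have "I h (push \<Omega>1 Tinv z) \<in> lagrange_space (\<T>1 h) k' \<Omega>1" using I_maps by blast
        with elim show ?case
          using lagrange_space_weak_grad[OF \<Omega>(4,5) tri1] by (auto simp: H1_def)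
      qed
      show "((\<lambda>h. H1norm \<Omega>1 (\<lambda>y. I h (push \<Omega>1 Tinv z) y - push \<Omega>1 Tinv z y)) \<longlongrightarrow> 0) (at 0 within H)"
        using H1_conv h0 z(1) by blast
    qed
    from order_tendstoD(2)[OF this az] zS show ?thesis
    proof eventually_elim
      case (elim h)
      have "?\<Lambda> h \<le> atilde \<Omega>0 \<Omega>1 Tinv (I h) z z"
        unfolding lambda_tilde_def
      proof (rule cInf_lower)
        \<comment> \<open>Without a lower bound the real infimum would be an unspecified value;
          nonnegativity of the discrete form provides one.\<close>
        show "bdd_below {atilde \<Omega>0 \<Omega>1 Tinv (I h) v v |v. v \<in> ?S h \<and> ?adm v}"
          by (rule bdd_belowI[of _ 0]) (use atilde_nonneg[OF \<Omega>(1,4)] in blast)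
      qed (use elim z(2) in blast)
      with elim show ?case by linarith
    qed
  qed
  show ?thesis
  proof (cases "\<exists>v. v \<in> H1 \<Omega>0 \<and> ?adm v")
    case True
    show ?thesis
    proof (rule ereal_le_epsilon2)
      fix e :: real assume e: "e > 0"
      \<comment> \<open>Half of e pays for near-optimality of v, the other half for the passage to
        the discrete problem.\<close>
      have "\<exists>a\<in>{aform \<Omega>0 \<Omega>1 Tinv v v |v. v \<in> H1 \<Omega>0 \<and> ?adm v}. a < lambda1 \<Omega>0 \<Omega>1 Tinv + e / 2"
        unfolding lambda1_def
      proof (rule cInf_lessD)
        show "{aform \<Omega>0 \<Omega>1 Tinv v v |v. v \<in> H1 \<Omega>0 \<and> ?adm v} \<noteq> {}" using True by blast
      qed (use e in simp)
      then obtain v where v: "v \<in> H1 \<Omega>0" "?adm v" "aform \<Omega>0 \<Omega>1 Tinv v v < lambda1 \<Omega>0 \<Omega>1 Tinv + e / 2"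
        by blast
      have "\<forall>\<^sub>F h in at 0 within H. ?\<Lambda> h < aform \<Omega>0 \<Omega>1 Tinv v v + e / 2"
        by (rule upper[OF v(1,2)]) (use e in simp)
      then have "\<forall>\<^sub>F h in at 0 within H. ereal (?\<Lambda> h) \<le> ereal (lambda1 \<Omega>0 \<Omega>1 Tinv) + ereal e"
        by eventually_elim (use v(3) in simp)
      then show "Limsup (at 0 within H) (\<lambda>h. ereal (?\<Lambda> h)) \<le> ereal (lambda1 \<Omega>0 \<Omega>1 Tinv) + ereal e"
        by (rule Limsup_bounded)
    qed
  next
    case False
    \<comment> \<open>Both infima are then the same junk value \<open>Inf {}\<close>.\<close>
    have "?\<Lambda> h = lambda1 \<Omega>0 \<Omega>1 Tinv" if "h \<in> H" for h
    proof -
      have "{atilde \<Omega>0 \<Omega>1 Tinv (I h) v v |v. v \<in> ?S h \<and> ?adm v} = {}"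
        using False S_H1[OF that] by blast
      moreover have "{aform \<Omega>0 \<Omega>1 Tinv v v |v. v \<in> H1 \<Omega>0 \<and> ?adm v} = {}"
        using False by blast
      ultimately show ?thesis by (simp only: lambda_tilde_def lambda1_def)
    qed
    then have "\<forall>\<^sub>F h in at 0 within H. ereal (?\<Lambda> h) \<le> ereal (lambda1 \<Omega>0 \<Omega>1 Tinv)"
      using inH by (auto elim: eventually_mono)
    then show ?thesis by (rule Limsup_bounded)
  qed
qed

end
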